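(* Let $g(t)=\exp(-\pi t^2)$ for $t\in\mathbb{R}$ and let \[ \Lambda=\{(-1,0),(1,0)\}\ \cup\ \left\{(0,\pm\sqrt{2n}) : n=1,2,3,\dots\right\}\ \cup\ \left\{(\pm\sqrt{2n},0) : n=1,2,3,\dots\right\}\subset\mathbb{R}^2 . \] Then the Gabor system $\mathcal{G}_{g,\Lambda}=\{\rho_{x,y}g : (x,y)\in\Lambda\}$ is a complete and minimal system in $L^2(\mathbb{R})$.
   Context: For $g\in L^2(\mathbb{R})$ and real numbers $x,y$, the time-frequency shift of $g$ with respect to the point $(x,y)$ is $\rho_{x,y}g(t)=e^{2\pi i y t}g(t-x)$. A system of vectors in $L^2(\mathbb{R})$ is complete if its linear span is dense in $L^2(\mathbb{R})$, and minimal if no vector of the system belongs to the closed linear span of the remaining vectors. *)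

theory Defs
  imports "HOL-Analysis.Analysis" "HOL-Library.Function_Algebras"
begin

text \<open>
  Elements of $L^2(\mathbb{R})$ are represented by functions rather than by almost-everywhere
  classes; \<open>L2_norm\<close> is accordingly only a seminorm, and \<open>L2_closure\<close> is closed under
  almost-everywhere equality.  Restricting to Borel functions loses nothing, since every
  Lebesgue measurable function is almost everywhere equal to a Borel one.
\<close>

definition L2 :: "(real \<Rightarrow> complex) set" where
  "L2 = {f. f \<in> borel_measurable lborel \<and> integrable lborel (\<lambda>t. (cmod (f t))\<^sup>2)}"

definition L2_norm :: "(real \<Rightarrow> complex) \<Rightarrow> real" where
  "L2_norm f = sqrt (LINT t|lborel. (cmod (f t))\<^sup>2)"

definition L2_closure :: "(real \<Rightarrow> complex) set \<Rightarrow> (real \<Rightarrow> complex) set" where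
  "L2_closure V = {f \<in> L2. \<forall>\<epsilon>>0. \<exists>h\<in>V. L2_norm (f - h) < \<epsilon>}"

definition cscale :: "complex \<Rightarrow> (real \<Rightarrow> complex) \<Rightarrow> real \<Rightarrow> complex" where
  "cscale c f = (\<lambda>t. c * f t)"

interpretation cfun: vector_space cscale
  by unfold_locales (auto simp: cscale_def fun_eq_iff algebra_simps)

definition complete_system :: "(real \<Rightarrow> complex) set \<Rightarrow> bool" where
  "complete_system S \<longleftrightarrow> S \<subseteq> L2 \<and> L2_closure (cfun.span S) = L2"

definition minimal_system :: "(real \<Rightarrow> complex) set \<Rightarrow> bool" where
  "minimal_system S \<longleftrightarrow> S \<subseteq> L2 \<and> (\<forall>f\<in>S. f \<notin> L2_closure (cfun.span (S - {f})))"

definition tf_shift :: "real \<Rightarrow> real \<Rightarrow> (real \<Rightarrow> complex) \<Rightarrow> real \<Rightarrow> complex" where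
  "tf_shift x y g = (\<lambda>t. exp (2 * of_real pi * \<i> * of_real y * of_real t) * g (t - x))"

definition gabor_system :: "(real \<Rightarrow> complex) \<Rightarrow> (real \<times> real) set \<Rightarrow> (real \<Rightarrow> complex) set" where
  "gabor_system g \<Lambda> = {tf_shift x y g | x y. (x, y) \<in> \<Lambda>}"

end

theory Submission
  imports Defs "HOL-Complex_Analysis.Complex_Analysis" "HOL-Probability.Probability"
begin

text \<open>
  Pairing \<open>f\<close> with the Gaussian shifted to \<open>(x, y)\<close> gives, up to the factor \<open>exp (- \<pi> x\<^sup>2)\<close>, the value at
  \<open>x - \<i> y\<close> of the entire function \<open>bargmann f z = \<integral> f(t) exp (2 \<pi> t z - \<pi> t\<^sup>2) dt\<close>. The points
  \<open>x - \<i> y\<close> with \<open>(x, y) \<in> \<Lambda>\<close> are the zeros of \<open>G(z) = (z\<^sup>2 - 1) sin (\<pi> z\<^sup>2 / 2) / z\<^sup>2\<close>: those of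
  \<open>sin (\<pi> z\<^sup>2 / 2)\<close>, with the double zero at the origin traded for the two zeros \<open>\<plusminus> 1\<close>.
  So both halves of the theorem are statements about \<open>G\<close> and the growth bound
  \<open>exp (\<pi> \<bar>z\<bar>\<^sup>2 / 2)\<close> that \<open>F(z) = exp (- \<pi> z\<^sup>2 / 2) bargmann f z\<close> satisfies for \<open>f \<in> L2\<close>. The function
  \<open>G\<close> itself attains this growth on the diagonals and just fails to come from an element of \<open>L2\<close>,
  while each \<open>G(z) / (z - \<kappa>)\<close> with \<open>G(\<kappa>) = 0\<close> does come from one.

  Completeness. If \<open>f\<close> is orthogonal to the system, then \<open>F = h G\<close> with \<open>h\<close> entire. Away from its
  zeros \<open>\<bar>G(z)\<bar>\<close> is comparable to \<open>exp (\<pi> \<bar>Im (z\<^sup>2)\<bar> / 2)\<close>, so \<open>h\<close> is bounded on the diagonals.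
  The sectors between the diagonals have the critical opening for
  order two, so the bound on the diagonals alone would not suffice for Phragmen and Lindelof; but on
  rays at angle \<open>\<epsilon>\<close> from a diagonal the exponent is only \<open>O(\<epsilon>\<^sup>2) \<bar>z\<bar>\<^sup>2\<close>, and the resulting
  majorant \<open>exp (O(\<epsilon>) Re (z\<^sup>2))\<close> disappears as \<open>\<epsilon> \<rightarrow> 0\<close> (\<open>wedge_bound\<close>, \<open>quadrant_bound\<close>). Hence
  \<open>h\<close> is constant, and since \<open>F(z) exp (- \<pi> \<bar>z\<bar>\<^sup>2 / 2)\<close> tends to \<open>0\<close> along the diagonal whereas
  \<open>G\<close> does not have this property, \<open>h = 0\<close> (\<open>fock_uniqueness\<close>). The transform is injective by uniqueness of
  characteristic functions (\<open>bargmann_injective\<close>), so \<open>f = 0\<close>; density of the span follows from the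
  projection theorem in \<open>L2\<close> (\<open>L2_closure_eq_if_orthogonal_trivial\<close>).

  Minimality. For every \<open>\<kappa>\<close> in the zero set a function of \<open>L2\<close> is needed whose transform vanishes
  at the other zeros but not at \<open>\<kappa>\<close> (\<open>exists_biorthogonal\<close>). It is built on the real line: up to a
  factor \<open>exp (\<pi> z\<^sup>2 / 2)\<close>, a combination of the two chirps \<open>exp (\<plusminus> \<i> \<pi> t\<^sup>2)\<close> has the transform
  \<open>sin (\<pi> z\<^sup>2 / 2)\<close>, and dividing a transform by \<open>z - a\<close> at one of its zeros \<open>a\<close> amounts to solving a
  first order linear differential equation, whose solution decays like \<open>1 / \<bar>t\<bar>\<close> and thus is in
  \<open>L2\<close> (\<open>bargmann_divide\<close>).
\<close>

section \<open>A Phragmen-Lindelof argument in quadrants\<close>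

text \<open>
  At a zero \<open>a\<close> of \<open>E\<close> both \<open>F\<close> and \<open>E\<close> are divided by \<open>z - a\<close>; since the zero is simple, the reduced
  denominator no longer vanishes at \<open>a\<close>, so the quotient extends holomorphically.
\<close>

lemma exists_entire_quotient:
  fixes F E :: "complex \<Rightarrow> complex"
  assumes F: "F holomorphic_on UNIV" and E: "E holomorphic_on UNIV"
    and zeros: "\<And>a. E a = 0 \<Longrightarrow> F a = 0 \<and> deriv E a \<noteq> 0"
  obtains h where "h holomorphic_on UNIV" "\<And>z. F z = h z * E z"
proof -
  define h where "h z = (if E z = 0 then deriv F z / deriv E z else F z / E z)" for z
  have an: "h analytic_on {a}" for a
  proof (cases "E a = 0")
    case False
    have "open {z. E z \<noteq> 0}"
      using E holomorphic_on_imp_continuous_on[OF E]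
      by (intro open_Collect_neq) auto
    moreover have "h holomorphic_on {z. E z \<noteq> 0}"
    proof (rule holomorphic_transform)
      show "(\<lambda>z. F z / E z) holomorphic_on {z. E z \<noteq> 0}"
        by (intro holomorphic_intros holomorphic_on_subset[OF F] holomorphic_on_subset[OF E]) auto
    qed (auto simp: h_def)
    ultimately show ?thesis
      using False by (auto simp: analytic_at)
  next
    case True
    define p where "p z = (if z = a then deriv F a else (F z - F a) / (z - a))" for z
    define e where "e z = (if z = a then deriv E a else (E z - E a) / (z - a))" for z
    have p: "p holomorphic_on UNIV" and e: "e holomorphic_on UNIV"
      unfolding p_def e_def using pole_lemma_open[OF F] pole_lemma_open[OF E] by auto
    have "e a \<noteq> 0" using zeros[OF True] by (simp add: e_def)
    have o: "open {z. e z \<noteq> 0}"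
      using holomorphic_on_imp_continuous_on[OF e] by (intro open_Collect_neq) auto
    have "h holomorphic_on {z. e z \<noteq> 0}"
    proof (rule holomorphic_transform)
      show "(\<lambda>z. p z / e z) holomorphic_on {z. e z \<noteq> 0}"
        by (intro holomorphic_intros holomorphic_on_subset[OF p] holomorphic_on_subset[OF e]) auto
      show "p z / e z = h z" if "z \<in> {z. e z \<noteq> 0}" for z
        using that zeros[OF True] True by (auto simp: p_def e_def h_def)
    qed
    then show ?thesis using o \<open>e a \<noteq> 0\<close> by (auto simp: analytic_at)
  qed
  show ?thesis
  proof
    show "h holomorphic_on UNIV"
      using an analytic_imp_holomorphic analytic_on_analytic_at by blast
    show "F z = h z * E z" for z
      using zeros[of z] by (auto simp: h_def)
  qed
qed

text \<open>
  The function \<open>w Ln (1 + w)\<close> serves as a damping exponent: its real part is bounded below on every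
  wedge \<open>\<bar>Im w\<bar> \<le> M Re w\<close>, yet it eventually exceeds any multiple of \<open>\<bar>w\<bar>\<close> there. Thus it beats growth
  of order two in \<open>z\<close> when \<open>w = z\<^sup>2\<close>, without the need for a fractional power.
\<close>

lemma Re_mult_Ln_ge:
  assumes "0 \<le> Re w" and "\<bar>Im w\<bar> \<le> M * Re w"
  shows "Re w * (ln (1 + Re w) - M * pi) \<le> Re (w * Ln (1 + w))"
proof -
  have nz: "1 + w \<noteq> 0" using assms(1)
    by (metis add.commute add_nonneg_pos less_numeral_extra(1) less_irrefl one_complex.sel(1) plus_complex.sel(1) zero_complex.sel(1))
  have "1 + Re w \<le> cmod (1 + w)"
    using complex_Re_le_cmod[of "1 + w"] by simp
  then have "ln (1 + Re w) \<le> Re (Ln (1 + w))"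
    using nz assms(1) by simp
  then have 1: "Re w * ln (1 + Re w) \<le> Re w * Re (Ln (1 + w))"
    using assms(1) by (intro mult_left_mono)
  have "Im w * Im (Ln (1 + w)) \<le> \<bar>Im w\<bar> * \<bar>Im (Ln (1 + w))\<bar>"
    by (metis abs_ge_self abs_mult)
  also have "\<dots> \<le> (M * Re w) * pi"
    using mpi_less_Im_Ln[OF nz] Im_Ln_le_pi[OF nz] assms
    by (intro mult_mono) auto
  finally show ?thesis using 1 by (simp add: algebra_simps)
qed

lemma Re_mult_Ln_ge_const:
  assumes "0 \<le> Re w" and "\<bar>Im w\<bar> \<le> M * Re w" and "0 \<le> M"
  shows "- (M * pi * exp (M * pi)) \<le> Re (w * Ln (1 + w))"
proof (rule order_trans[OF _ Re_mult_Ln_ge[OF assms(1,2)]])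
  show "- (M * pi * exp (M * pi)) \<le> Re w * (ln (1 + Re w) - M * pi)"
  proof (cases "M * pi \<le> ln (1 + Re w)")
    case True
    then have "0 \<le> Re w * (ln (1 + Re w) - M * pi)" using assms(1) by simp
    moreover have "0 \<le> M * pi * exp (M * pi)" using assms(3) by simp
    ultimately show ?thesis by linarith
  next
    case False
    then have "1 + Re w \<le> exp (M * pi)"
      using assms(1) by (metis add_nonneg_pos add.commute exp_le_cancel_iff exp_ln less_eq_real_def not_le zero_less_one)
    then have "Re w * (M * pi) \<le> exp (M * pi) * (M * pi)"
      using assms by (intro mult_right_mono) auto
    moreover have "0 \<le> Re w * ln (1 + Re w)" using assms(1) by simp
    ultimately show ?thesis by (simp add: algebra_simps)
  qed
qed

text \<open>
  With \<open>w = z\<^sup>2\<close> the region is the wedge \<open>\<bar>Im w\<bar> \<le> M Re w\<close>, that is, two opposite sectors of opening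
  strictly less than a right angle, for which growth of order two is subcritical. The bound
  \<open>far\<close> is asked for on the lines \<open>Re w = 2 n + 1\<close> only, since that is where a lower bound for
  \<open>sin (\<pi> w / 2)\<close> holds.
\<close>

lemma wedge_bound:
  fixes h :: "complex \<Rightarrow> complex"
  assumes hol: "h holomorphic_on UNIV" and "1 \<le> M" "0 \<le> A" "0 \<le> C"
    and edge: "\<And>z. 0 \<le> Re (z\<^sup>2) \<Longrightarrow> \<bar>Im (z\<^sup>2)\<bar> = M * Re (z\<^sup>2) \<Longrightarrow> cmod (h z) \<le> C * exp (A * Re (z\<^sup>2))"
    and far: "\<And>z n. 1 \<le> n \<Longrightarrow> Re (z\<^sup>2) = 2 * real n + 1 \<Longrightarrow> cmod (h z) \<le> C * exp (B * (cmod z)\<^sup>2)"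
    and z: "0 \<le> Re (z\<^sup>2)" "\<bar>Im (z\<^sup>2)\<bar> \<le> M * Re (z\<^sup>2)" and "0 \<le> B"
  shows "cmod (h z) \<le> C * exp (A * Re (z\<^sup>2))"
proof -
  define K where "K = M * pi * exp (M * pi)"
  have "0 \<le> K" using assms by (simp add: K_def)
  have main: "cmod (h z) \<le> C * exp (d * K) * exp (A * Re (z\<^sup>2) + d * Re (z\<^sup>2 * Ln (1 + z\<^sup>2)))"
    if d: "0 < d" for d
  proof -
    \<comment> \<open>The factor with \<open>A\<close> normalizes the bound on the edges; the one with \<open>d\<close> forces decay at infinity.\<close>
    define \<phi> where "\<phi> z = h z * exp (- (of_real A * z\<^sup>2) - of_real d * (z\<^sup>2 * Ln (1 + z\<^sup>2)))" for z
    have cm: "cmod (\<phi> z) = cmod (h z) * exp (- (A * Re (z\<^sup>2)) - d * Re (z\<^sup>2 * Ln (1 + z\<^sup>2)))" for z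
      by (simp add: \<phi>_def norm_mult)
    \<comment> \<open>The truncation level \<open>n\<close> is so large that the damping beats the growth on the far side.\<close>
    have "filterlim (\<lambda>n. ln (1 + (2 * real n + 1))) at_top sequentially" by real_asymp
    then have "\<forall>\<^sub>F n in sequentially. M * pi + B * (1 + M) / d \<le> ln (1 + (2 * real n + 1))"
      by (simp add: filterlim_at_top)
    moreover have "filterlim (\<lambda>n. 2 * real n + 1) at_top sequentially" by real_asymp
    then have "\<forall>\<^sub>F n in sequentially. Re (z\<^sup>2) \<le> 2 * real n + 1"
      by (simp add: filterlim_at_top)
    ultimately have "\<forall>\<^sub>F n in sequentially. M * pi + B * (1 + M) / d \<le> ln (1 + (2 * real n + 1))
        \<and> Re (z\<^sup>2) \<le> 2 * real n + 1 \<and> 1 \<le> n"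
      using eventually_ge_at_top[of 1] by eventually_elim auto
    then obtain n where n: "M * pi + B * (1 + M) / d \<le> ln (1 + (2 * real n + 1))"
      "Re (z\<^sup>2) \<le> 2 * real n + 1" "1 \<le> n"
      by (auto dest: eventually_happens)
    define N where "N = 2 * real n + 1"
    define T where "T = {z. \<bar>Im (z\<^sup>2)\<bar> \<le> M * Re (z\<^sup>2) \<and> Re (z\<^sup>2) \<le> N}"
    define T' where "T' = {z. \<bar>Im (z\<^sup>2)\<bar> < M * Re (z\<^sup>2) \<and> Re (z\<^sup>2) < N}"
    have T0: "0 \<le> Re (z\<^sup>2)" if "z \<in> T" for z
    proof -
      have "0 \<le> M * Re (z\<^sup>2)" using that unfolding T_def by (auto intro: order_trans[OF abs_ge_zero])
      then show ?thesis using \<open>1 \<le> M\<close> by (simp add: zero_le_mult_iff)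
    qed
    \<comment> \<open>Here \<open>\<bar>z\<bar>\<^sup>2 = \<bar>z\<^sup>2\<bar>\<close> is bounded by the sum of the absolute values of the coordinates of \<open>z\<^sup>2\<close>.\<close>
    have w: "(cmod z)\<^sup>2 \<le> (1 + M) * Re (z\<^sup>2)" if "z \<in> T" for z
      using cmod_le[of "z\<^sup>2"] T0[OF that] that unfolding T_def by (auto simp: norm_power algebra_simps)
    have clT: "closed T" unfolding T_def Collect_conj_eq
      by (intro closed_Int closed_Collect_le continuous_intros)
    have "T' \<subseteq> T" by (auto simp: T_def T'_def)
    moreover have "open T'" unfolding T'_def Collect_conj_eq
      by (intro open_Int open_Collect_less continuous_intros)
    ultimately have "T' \<subseteq> interior T" by (rule interior_maximal)
    then have fr: "frontier T \<subseteq> T - T'" using clT by (auto simp: frontier_def)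
    have bT: "bounded T"
    proof (rule boundedI)
      fix z assume "z \<in> T"
      then have "(cmod z)\<^sup>2 \<le> (1 + M) * N"
        using w[of z] \<open>1 \<le> M\<close> mult_left_mono[of "Re (z\<^sup>2)" N "1 + M"]
        unfolding T_def by (smt (verit) mem_Collect_eq)
      then show "cmod z \<le> sqrt ((1 + M) * N)" by (simp add: real_le_rsqrt)
    qed
    have hol\<phi>: "\<phi> holomorphic_on T" unfolding \<phi>_def
    proof (intro holomorphic_intros holomorphic_on_subset[OF hol])
      fix x assume "x \<in> T"
      from T0[OF this] have "0 < Re (1 + x\<^sup>2)" by simp
      then show "1 + x\<^sup>2 \<notin> \<real>\<^sub>\<le>\<^sub>0"
        unfolding complex_nonpos_Reals_iff by linarith
    qed auto
    have "cmod (\<phi> z) \<le> C * exp (d * K)"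
    proof (rule maximum_modulus_frontier[where S = T and f = \<phi> and \<xi> = z])
      show "\<phi> holomorphic_on interior T" using hol\<phi> holomorphic_on_subset interior_subset by blast
      show "continuous_on (closure T) \<phi>"
        using clT hol\<phi> holomorphic_on_imp_continuous_on by (simp add: closure_closed)
      show "bounded T" by fact
      show "z \<in> T" using z n(2) by (simp add: T_def N_def)
    next
      fix y assume "y \<in> frontier T"
      then have yT: "y \<in> T" and "y \<notin> T'" using fr by auto
      then have "\<bar>Im (y\<^sup>2)\<bar> = M * Re (y\<^sup>2) \<or> Re (y\<^sup>2) = N"
        by (auto simp: T_def T'_def)
      then show "cmod (\<phi> y) \<le> C * exp (d * K)"
      proof
        assume "\<bar>Im (y\<^sup>2)\<bar> = M * Re (y\<^sup>2)"
        then have h: "cmod (h y) \<le> C * exp (A * Re (y\<^sup>2))" using edge T0[OF yT] by blast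
        have "- K \<le> Re (y\<^sup>2 * Ln (1 + y\<^sup>2))" unfolding K_def
          using yT T0[OF yT] \<open>1 \<le> M\<close> by (intro Re_mult_Ln_ge_const) (auto simp: T_def)
        then have "d * (- K) \<le> d * Re (y\<^sup>2 * Ln (1 + y\<^sup>2))"
          using d by (intro mult_left_mono) auto
        then have "exp (A * Re (y\<^sup>2)) * exp (- (A * Re (y\<^sup>2)) - d * Re (y\<^sup>2 * Ln (1 + y\<^sup>2))) \<le> exp (d * K)"
          unfolding exp_add[symmetric] by simp
        then have "C * (exp (A * Re (y\<^sup>2)) * exp (- (A * Re (y\<^sup>2)) - d * Re (y\<^sup>2 * Ln (1 + y\<^sup>2)))) \<le> C * exp (d * K)"
          using \<open>0 \<le> C\<close> by (rule mult_left_mono)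
        moreover have "cmod (\<phi> y) \<le> (C * exp (A * Re (y\<^sup>2))) * exp (- (A * Re (y\<^sup>2)) - d * Re (y\<^sup>2 * Ln (1 + y\<^sup>2)))"
          unfolding cm using h by (intro mult_right_mono) auto
        ultimately show ?thesis by (simp add: mult.assoc)
      next
        assume N: "Re (y\<^sup>2) = N"
        then have h: "cmod (h y) \<le> C * exp (B * (cmod y)\<^sup>2)" using far n(3) by (simp add: N_def)
        have "B * (cmod y)\<^sup>2 \<le> B * ((1 + M) * N)"
          using w[OF yT] N \<open>0 \<le> B\<close> by (intro mult_left_mono) auto
        moreover have "N * (ln (1 + N) - M * pi) \<le> Re (y\<^sup>2 * Ln (1 + y\<^sup>2))"
          using Re_mult_Ln_ge[of "y\<^sup>2" M] T0[OF yT] yT N by (auto simp: T_def)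
        then have "d * (N * (ln (1 + N) - M * pi)) \<le> d * Re (y\<^sup>2 * Ln (1 + y\<^sup>2))"
          using d by (intro mult_left_mono) auto
        moreover have "d * N * (B * (1 + M) / d) \<le> d * N * (ln (1 + N) - M * pi)"
          using n(1) d by (intro mult_left_mono) (auto simp: N_def)
        moreover have "d * N * (B * (1 + M) / d) = B * ((1 + M) * N)" using d by simp
        ultimately have "B * ((1 + M) * N) \<le> d * (N * (ln (1 + N) - M * pi))"
          and "B * (cmod y)\<^sup>2 \<le> B * ((1 + M) * N)"
          and "d * (N * (ln (1 + N) - M * pi)) \<le> d * Re (y\<^sup>2 * Ln (1 + y\<^sup>2))"
          by (simp_all add: mult.assoc)
        moreover have "0 \<le> A * Re (y\<^sup>2)" "0 \<le> d * K" using \<open>0 \<le> A\<close> T0[OF yT] d \<open>0 \<le> K\<close> by auto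
        ultimately have "exp (B * (cmod y)\<^sup>2) * exp (- (A * Re (y\<^sup>2)) - d * Re (y\<^sup>2 * Ln (1 + y\<^sup>2))) \<le> exp (d * K)"
          unfolding exp_add[symmetric] exp_le_cancel_iff by linarith
        then have "C * (exp (B * (cmod y)\<^sup>2) * exp (- (A * Re (y\<^sup>2)) - d * Re (y\<^sup>2 * Ln (1 + y\<^sup>2)))) \<le> C * exp (d * K)"
          using \<open>0 \<le> C\<close> by (rule mult_left_mono)
        moreover have "cmod (\<phi> y) \<le> (C * exp (B * (cmod y)\<^sup>2)) * exp (- (A * Re (y\<^sup>2)) - d * Re (y\<^sup>2 * Ln (1 + y\<^sup>2)))"
          unfolding cm using h by (intro mult_right_mono) auto
        ultimately show ?thesis by (simp add: mult.assoc)
      qed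
    qed
    then have "cmod (\<phi> z) * exp (A * Re (z\<^sup>2) + d * Re (z\<^sup>2 * Ln (1 + z\<^sup>2))) \<le> C * exp (d * K) * exp (A * Re (z\<^sup>2) + d * Re (z\<^sup>2 * Ln (1 + z\<^sup>2)))"
      by (intro mult_right_mono) auto
    then show ?thesis
      unfolding cm mult.assoc exp_add[symmetric] by (simp add: exp_add[symmetric])
  qed
  have "((\<lambda>d. C * exp (d * K) * exp (A * Re (z\<^sup>2) + d * Re (z\<^sup>2 * Ln (1 + z\<^sup>2)))) \<longlongrightarrow>
      C * exp (0 * K) * exp (A * Re (z\<^sup>2) + 0 * Re (z\<^sup>2 * Ln (1 + z\<^sup>2)))) (at_right 0)"
    by (intro tendsto_intros)
  then have "cmod (h z) \<le> C * exp (0 * K) * exp (A * Re (z\<^sup>2) + 0 * Re (z\<^sup>2 * Ln (1 + z\<^sup>2)))"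
  proof (rule tendsto_lowerbound)
    show "\<forall>\<^sub>F d in at_right 0. cmod (h z) \<le> C * exp (d * K) * exp (A * Re (z\<^sup>2) + d * Re (z\<^sup>2 * Ln (1 + z\<^sup>2)))"
      using eventually_at_right_less by eventually_elim (rule main)
  qed simp
  then show ?thesis by simp
qed

text \<open>
  Here the sectors have the critical opening. On the edge \<open>\<bar>Im w\<bar> = M Re w\<close> of a narrower wedge the
  exponent is \<open>\<pi> / 2\<close> times \<open>\<bar>w\<bar> - \<bar>Im w\<bar> = (sqrt (1 + M\<^sup>2) - M) Re w \<le> Re w / (2 M)\<close>, so that
  the bound obtained inside the wedge tends to \<open>C\<close> as \<open>M\<close> grows.
\<close>

lemma quadrant_bound:
  fixes h :: "complex \<Rightarrow> complex"
  assumes hol: "h holomorphic_on UNIV" and C: "0 \<le> C"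
    and edge: "\<And>z. 1 \<le> \<bar>Im (z\<^sup>2)\<bar> \<Longrightarrow> cmod (h z) \<le> C * exp (pi / 2 * ((cmod z)\<^sup>2 - \<bar>Im (z\<^sup>2)\<bar>))"
    and far: "\<And>z n. 1 \<le> n \<Longrightarrow> Re (z\<^sup>2) = 2 * real n + 1 \<Longrightarrow> cmod (h z) \<le> C * exp (pi / 2 * (cmod z)\<^sup>2)"
    and small: "\<And>z. cmod z \<le> 2 \<Longrightarrow> cmod (h z) \<le> C"
    and z: "0 < Re (z\<^sup>2)"
  shows "cmod (h z) \<le> C"
proof -
  have "cmod (h z) \<le> C * exp (pi / 4 / M * Re (z\<^sup>2))" if M: "1 \<le> M" "\<bar>Im (z\<^sup>2)\<bar> / Re (z\<^sup>2) \<le> M" for M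
  proof (rule wedge_bound[where h = h and M = M and z = z, OF hol M(1) _ C _ far])
    show "\<bar>Im (z\<^sup>2)\<bar> \<le> M * Re (z\<^sup>2)" using M(2) z by (simp add: field_simps)
    fix y assume y: "0 \<le> Re (y\<^sup>2)" "\<bar>Im (y\<^sup>2)\<bar> = M * Re (y\<^sup>2)"
    define u where "u = Re (y\<^sup>2)"
    have ny: "(cmod y)\<^sup>2 = cmod (y\<^sup>2)" by (simp add: norm_power)
    show "cmod (h y) \<le> C * exp (pi / 4 / M * Re (y\<^sup>2))"
    proof (cases "1 \<le> \<bar>Im (y\<^sup>2)\<bar>")
      case True
      have "(cmod (y\<^sup>2))\<^sup>2 = u\<^sup>2 + (M * u)\<^sup>2"
        unfolding cmod_power2 using y by (metis u_def power2_abs)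
      also have "\<dots> \<le> (M * u + u / (2 * M))\<^sup>2"
        using M(1) by (simp add: power2_eq_square field_simps)
      finally have "cmod (y\<^sup>2) \<le> M * u + u / (2 * M)"
        using y M(1) by (auto intro!: power2_le_imp_le simp: u_def)
      then have "(cmod y)\<^sup>2 - \<bar>Im (y\<^sup>2)\<bar> \<le> u / (2 * M)"
        using y unfolding ny u_def by linarith
      then have "pi / 2 * ((cmod y)\<^sup>2 - \<bar>Im (y\<^sup>2)\<bar>) \<le> pi / 2 * (u / (2 * M))"
        by (intro mult_left_mono) auto
      also have "\<dots> = pi / 4 / M * Re (y\<^sup>2)" by (simp add: u_def)
      finally show ?thesis
        using edge[OF True] C by (meson exp_le_cancel_iff mult_left_mono order_trans)
    next
      case False
      then have "M * u < 1" using y by (simp add: u_def)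
      moreover have "u \<le> M * u" using M(1) y(1) mult_right_mono[of 1 M u] by (simp add: u_def)
      ultimately have "cmod (y\<^sup>2) \<le> 2" using cmod_le[of "y\<^sup>2"] False y(1) unfolding u_def by linarith
      then have "(cmod y)\<^sup>2 \<le> 2\<^sup>2" unfolding ny by simp
      then have "cmod (h y) \<le> C" by (intro small) (rule power2_le_imp_le, auto)
      also have "\<dots> \<le> C * exp (pi / 4 / M * Re (y\<^sup>2))"
        using y(1) M(1) C by (simp add: mult_le_cancel_left1)
      finally show ?thesis .
    qed
  qed (use z M in auto)
  then have "\<forall>\<^sub>F M in at_top. cmod (h z) \<le> C * exp (pi / 4 / M * Re (z\<^sup>2))"
    by (intro eventually_at_top_linorderI[of "max 1 (\<bar>Im (z\<^sup>2)\<bar> / Re (z\<^sup>2))"]) auto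
  moreover have "((\<lambda>M. C * exp (pi / 4 / M * Re (z\<^sup>2))) \<longlongrightarrow> C) at_top" by real_asymp
  ultimately show ?thesis by (intro tendsto_lowerbound) auto
qed

text \<open>
  The hypotheses are invariant under \<open>z \<mapsto> \<i> z\<close>, which exchanges the sectors \<open>Re (z\<^sup>2) > 0\<close> and
  \<open>Re (z\<^sup>2) < 0\<close>; Liouville's theorem then applies.
\<close>

lemma entire_bounded_of_quadrants:
  fixes h :: "complex \<Rightarrow> complex"
  assumes hol: "h holomorphic_on UNIV" and "0 \<le> C"
    and edge: "\<And>z. 1 \<le> \<bar>Im (z\<^sup>2)\<bar> \<Longrightarrow> cmod (h z) \<le> C * exp (pi / 2 * ((cmod z)\<^sup>2 - \<bar>Im (z\<^sup>2)\<bar>))"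
    and far: "\<And>z n. 1 \<le> n \<Longrightarrow> \<bar>Re (z\<^sup>2)\<bar> = 2 * real n + 1 \<Longrightarrow> cmod (h z) \<le> C * exp (pi / 2 * (cmod z)\<^sup>2)"
  shows "h constant_on UNIV"
proof -
  have "compact (h ` cball 0 2)"
    by (intro compact_continuous_image holomorphic_on_imp_continuous_on holomorphic_on_subset[OF hol]) auto
  then obtain B where "\<forall>w \<in> h ` cball 0 2. cmod w \<le> B"
    using compact_imp_bounded bounded_iff by metis
  then have B: "\<And>z. cmod z \<le> 2 \<Longrightarrow> cmod (h z) \<le> B" by simp
  define D where "D = max C B"
  have D: "0 \<le> D" "C \<le> D" "\<And>z. cmod z \<le> 2 \<Longrightarrow> cmod (h z) \<le> D"
    using B \<open>0 \<le> C\<close> by (auto simp: D_def le_max_iff_disj)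
  have edge': "cmod (h z) \<le> D * exp (pi / 2 * ((cmod z)\<^sup>2 - \<bar>Im (z\<^sup>2)\<bar>))" if "1 \<le> \<bar>Im (z\<^sup>2)\<bar>" for z
    by (rule order_trans[OF edge[OF that]]) (intro mult_right_mono D, simp)
  have far': "cmod (h z) \<le> D * exp (pi / 2 * (cmod z)\<^sup>2)" if "1 \<le> n" "\<bar>Re (z\<^sup>2)\<bar> = 2 * real n + 1" for z n
    by (rule order_trans[OF far[OF that]]) (intro mult_right_mono D, simp)
  have "cmod (h z) \<le> D" for z
  proof (rule linorder_cases[of "Re (z\<^sup>2)" 0])
    assume "0 < Re (z\<^sup>2)"
    then show ?thesis
      using far' by (intro quadrant_bound[OF hol D(1) edge' _ D(3)]) auto
  next
    assume z: "Re (z\<^sup>2) < 0"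
    define k where "k y = h (\<i> * y)" for y
    have "cmod (k (- \<i> * z)) \<le> D"
    proof (rule quadrant_bound[where h = k and z = "- \<i> * z", OF _ D(1)])
      have "(h \<circ> (*) \<i>) holomorphic_on UNIV"
        by (rule holomorphic_on_compose_gen[OF _ hol]) (auto intro!: holomorphic_intros)
      then show "k holomorphic_on UNIV" by (simp add: k_def[abs_def] o_def)
      show "cmod (k y) \<le> D * exp (pi / 2 * ((cmod y)\<^sup>2 - \<bar>Im (y\<^sup>2)\<bar>))" if "1 \<le> \<bar>Im (y\<^sup>2)\<bar>" for y
        using edge'[of "\<i> * y"] that by (simp add: k_def norm_mult power_mult_distrib)
      show "cmod (k y) \<le> D * exp (pi / 2 * (cmod y)\<^sup>2)" if "1 \<le> n" "Re (y\<^sup>2) = 2 * real n + 1" for y n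
        using far'[of n "\<i> * y"] that by (simp add: k_def norm_mult power_mult_distrib)
      show "cmod (k y) \<le> D" if "cmod y \<le> 2" for y
        using D(3)[of "\<i> * y"] that by (simp add: k_def norm_mult)
      show "0 < Re ((- \<i> * z)\<^sup>2)" using z by (simp add: power_mult_distrib)
    qed
    then show ?thesis by (simp add: k_def)
  next
    assume z: "Re (z\<^sup>2) = 0"
    then have *: "(cmod z)\<^sup>2 = \<bar>Im (z\<^sup>2)\<bar>"
      by (simp add: norm_power[symmetric] cmod_eq_Im)
    show ?thesis
    proof (cases "1 \<le> \<bar>Im (z\<^sup>2)\<bar>")
      case True
      from edge'[OF this] show ?thesis by (simp add: *)
    next
      case False
      then have "(cmod z)\<^sup>2 \<le> 2\<^sup>2" using * by simp
      then show ?thesis by (intro D(3)) (rule power2_le_imp_le, auto)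
    qed
  qed
  then have "bounded (range h)" by (auto intro!: boundedI)
  then show ?thesis using Liouville_theorem[OF hol] by (auto simp: constant_on_def)
qed

section \<open>Uniqueness of functions of Fock growth on the zero set\<close>

text \<open>
  The image of the index set of the Gabor system under \<open>(x, y) \<mapsto> x - \<i> y\<close>, written as the zero set of
  an entire function.
\<close>

definition sampling_set :: "complex set" where
  "sampling_set = {z. z\<^sup>2 = 1 \<or> z \<noteq> 0 \<and> sin (of_real pi * z\<^sup>2 / 2) = 0}"

lemma cmod_sin_ge_exp:
  assumes "1/2 \<le> \<bar>Im z\<bar>"
  shows "exp \<bar>Im z\<bar> / 4 \<le> cmod (sin z)"
proof -
  define b where "b = \<bar>Im z\<bar>"
  have "(exp b)\<^sup>2 + inverse ((exp b)\<^sup>2) = exp (2 * Im z) + inverse (exp (2 * Im z))"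
    unfolding b_def exp_double[symmetric] by (cases "0 \<le> Im z") (auto simp: exp_minus[symmetric] add.commute)
  then have "(cmod (sin z))\<^sup>2 = ((exp b)\<^sup>2 + inverse ((exp b)\<^sup>2) - 2 * cos (2 * Re z)) / 4"
    unfolding norm_sin_squared by simp
  also have "\<dots> \<ge> ((exp b)\<^sup>2 + inverse ((exp b)\<^sup>2) - 2) / 4"
    by simp
  finally have 1: "((exp b)\<^sup>2 + inverse ((exp b)\<^sup>2) - 2) / 4 \<le> (cmod (sin z))\<^sup>2" .
  have "1 + 2 * b \<le> exp (2 * b)" by (rule exp_ge_add_one_self)
  then have 2: "2 \<le> (exp b)\<^sup>2" using assms unfolding exp_double[symmetric] b_def by linarith
  define x where "x = (exp b)\<^sup>2"
  have "x / 16 \<le> (x + inverse x - 2) / 4"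
  proof -
    have "0 \<le> 3 * (x - 2) * (x - 2/3)" using 2 by (simp add: x_def)
    then have "8 * x \<le> 3 * x\<^sup>2 + 4" by (simp add: algebra_simps power2_eq_square)
    moreover have "0 < x" using 2 by (simp add: x_def)
    ultimately show ?thesis by (simp add: field_simps power2_eq_square)
  qed
  then have "(exp b / 4)\<^sup>2 \<le> (cmod (sin z))\<^sup>2" using 1 by (simp add: x_def power_divide)
  then show ?thesis unfolding b_def by (rule power2_le_imp_le) simp
qed

lemma cmod_sin_ge_1:
  assumes "cos (2 * Re z) = - 1"
  shows "1 \<le> cmod (sin z)"
proof -
  have "2 \<le> exp (2 * Im z) + inverse (exp (2 * Im z))"
    using exp_ge_add_one_self[of "2 * Im z"] exp_ge_add_one_self[of "- (2 * Im z)"]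
    unfolding exp_minus by linarith
  then have "1\<^sup>2 \<le> (cmod (sin z))\<^sup>2" unfolding norm_sin_squared using assms by simp
  then show ?thesis by (rule power2_le_imp_le) simp
qed

text \<open>
  The generating function \<open>(z\<^sup>2 - 1) sin (\<pi> z\<^sup>2 / 2) / z\<^sup>2\<close>, extended over the origin. The derivative at a zero
  is read off by differentiating the product relation, in which \<open>z\<^sup>2\<close> is nonzero there.
\<close>

lemma exists_generating_function:
  obtains E :: "complex \<Rightarrow> complex" where "E holomorphic_on UNIV"
    "\<And>z. z\<^sup>2 * E z = (z\<^sup>2 - 1) * sin (of_real pi * z\<^sup>2 / 2)"
    "\<And>z. E z = 0 \<Longrightarrow> z \<in> sampling_set \<and> deriv E z \<noteq> 0"
proof -
  define \<sigma> :: "complex \<Rightarrow> complex" where "\<sigma> w = (if w = 0 then deriv sin 0 else (sin w - sin 0) / (w - 0))" for w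
  have \<sigma>: "\<sigma> holomorphic_on UNIV"
    unfolding \<sigma>_def by (intro pole_lemma_open holomorphic_intros) auto
  have "deriv sin (0::complex) = 1" by (simp add: DERIV_imp_deriv[OF DERIV_sin])
  then have \<sigma>0: "\<sigma> 0 = 1" and \<sigma>eq: "\<And>w. w * \<sigma> w = sin w" by (auto simp: \<sigma>_def)
  define E where "E z = (z\<^sup>2 - 1) * (of_real pi / 2) * \<sigma> (of_real pi * z\<^sup>2 / 2)" for z :: complex
  have hol: "E holomorphic_on UNIV"
  proof -
    have "(\<sigma> \<circ> (\<lambda>z. of_real pi * z\<^sup>2 / 2)) holomorphic_on UNIV"
      by (rule holomorphic_on_compose_gen[OF _ \<sigma>]) (auto intro!: holomorphic_intros)
    then show ?thesis unfolding E_def o_def by (intro holomorphic_intros)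
  qed
  have eq: "z\<^sup>2 * E z = (z\<^sup>2 - 1) * sin (of_real pi * z\<^sup>2 / 2)" for z
    unfolding E_def \<sigma>eq[symmetric] by (simp add: algebra_simps)
  have "z \<in> sampling_set \<and> deriv E z \<noteq> 0" if "E z = 0" for z
  proof -
    have "z \<noteq> 0" using that by (auto simp: E_def \<sigma>0)
    then have z: "z\<^sup>2 = 1 \<or> sin (of_real pi * z\<^sup>2 / 2) = 0" using eq[of z] that by auto
    have "(E has_field_derivative deriv E z) (at z)"
      using holomorphic_derivI[OF hol] by simp
    then have "((\<lambda>z. z\<^sup>2 * E z) has_field_derivative z\<^sup>2 * deriv E z) (at z)"
      using that by (auto intro!: derivative_eq_intros)
    moreover have "((\<lambda>z. (z\<^sup>2 - 1) * sin (of_real pi * z\<^sup>2 / 2)) has_field_derivative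
        2 * z * sin (of_real pi * z\<^sup>2 / 2) + (z\<^sup>2 - 1) * (cos (of_real pi * z\<^sup>2 / 2) * (of_real pi * z))) (at z)"
      by (auto intro!: derivative_eq_intros)
    ultimately have d: "z\<^sup>2 * deriv E z = 2 * z * sin (of_real pi * z\<^sup>2 / 2) + (z\<^sup>2 - 1) * (cos (of_real pi * z\<^sup>2 / 2) * (of_real pi * z))"
      unfolding eq by (rule DERIV_unique)
    have s1: "sin (of_real pi / 2 :: complex) = 1"
      by (metis of_real_1 of_real_divide of_real_numeral sin_of_real sin_pi_half)
    have "deriv E z \<noteq> 0"
    proof (cases "z\<^sup>2 = 1")
      case True
      then show ?thesis using d s1 \<open>z \<noteq> 0\<close> by auto
    next
      case False
      then have "sin (of_real pi * z\<^sup>2 / 2) = 0" using z by simp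
      moreover from this have "cos (of_real pi * z\<^sup>2 / 2) \<noteq> 0"
        by (metis sin_cos_squared_add add_0_left power_zero_numeral zero_neq_one)
      ultimately show ?thesis using d False \<open>z \<noteq> 0\<close> by auto
    qed
    then show ?thesis using z \<open>z \<noteq> 0\<close> by (auto simp: sampling_set_def)
  qed
  then show ?thesis using that[OF hol eq] by blast
qed

text \<open>
  Dividing \<open>F\<close> by the generating function leaves a constant, by the bounds on the sine on
  \<open>\<bar>Im (z\<^sup>2)\<bar> \<ge> 1\<close> and on the lines where \<open>\<bar>Re (z\<^sup>2)\<bar>\<close> is an odd integer. On the diagonal the generating
  function has modulus at least a constant times \<open>exp (\<pi> x\<^sup>2)\<close>, so \<open>diag\<close> forces the constant to be \<open>0\<close>.
\<close>

lemma fock_uniqueness: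
  fixes F :: "complex \<Rightarrow> complex"
  assumes hol: "F holomorphic_on UNIV"
    and growth: "\<And>z. cmod (F z) \<le> C * exp (pi / 2 * (cmod z)\<^sup>2)"
    and zero: "\<And>z. z \<in> sampling_set \<Longrightarrow> F z = 0"
    and diag: "((\<lambda>x. cmod (F (Complex x x)) * exp (- pi * x\<^sup>2)) \<longlongrightarrow> 0) at_top"
  shows "F z = 0"
proof -
  obtain E where E: "E holomorphic_on UNIV"
    "\<And>z. z\<^sup>2 * E z = (z\<^sup>2 - 1) * sin (of_real pi * z\<^sup>2 / 2)"
    "\<And>z. E z = 0 \<Longrightarrow> z \<in> sampling_set \<and> deriv E z \<noteq> 0"
    by (rule exists_generating_function) blast
  obtain h where h: "h holomorphic_on UNIV" "\<And>z. F z = h z * E z"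
    using exists_entire_quotient[OF hol E(1)] E(3) zero by metis
  have C: "0 \<le> C"
  proof -
    have "0 \<le> C * exp (pi / 2 * (cmod 0)\<^sup>2)" using growth[of 0] norm_ge_zero order_trans by blast
    then show ?thesis by simp
  qed
  \<comment> \<open>The constant \<open>2\<close> bounds \<open>\<bar>z\<^sup>2 / (z\<^sup>2 - 1)\<bar> = \<bar>1 + 1 / (z\<^sup>2 - 1)\<bar>\<close>.\<close>
  have q: "cmod (h z) * cmod (sin (of_real pi * z\<^sup>2 / 2)) \<le> 2 * (C * exp (pi / 2 * (cmod z)\<^sup>2))"
    if "1 \<le> cmod (z\<^sup>2 - 1)" for z
  proof -
    have "h z * sin (of_real pi * z\<^sup>2 / 2) * (z\<^sup>2 - 1) = F z * z\<^sup>2"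
      unfolding h(2) using E(2)[of z] by (simp add: ac_simps)
    then have "cmod (h z) * cmod (sin (of_real pi * z\<^sup>2 / 2)) * cmod (z\<^sup>2 - 1) = cmod (F z) * cmod (z\<^sup>2)"
      by (metis norm_mult)
    also have "\<dots> \<le> cmod (F z) * (2 * cmod (z\<^sup>2 - 1))"
    proof (rule mult_left_mono)
      have "cmod (z\<^sup>2) \<le> cmod (z\<^sup>2 - 1) + cmod 1" by (metis diff_add_cancel norm_triangle_ineq)
      then show "cmod (z\<^sup>2) \<le> 2 * cmod (z\<^sup>2 - 1)" using that by simp
    qed simp
    finally have "cmod (h z) * cmod (sin (of_real pi * z\<^sup>2 / 2)) * cmod (z\<^sup>2 - 1) \<le> 2 * cmod (F z) * cmod (z\<^sup>2 - 1)"
      by (simp add: ac_simps)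
    then have "cmod (h z) * cmod (sin (of_real pi * z\<^sup>2 / 2)) \<le> 2 * cmod (F z)"
      by (rule mult_right_le_imp_le) (use that in linarith)
    then show ?thesis using growth[of z] by linarith
  qed
  have imr: "Im (of_real pi * w / 2) = pi / 2 * Im w" "Re (of_real pi * w / 2) = pi / 2 * Re w" for w
    by simp_all
  have "h constant_on UNIV"
  proof (rule entire_bounded_of_quadrants[OF h(1)])
    show "0 \<le> 8 * C" using C by simp
    show "cmod (h z) \<le> 8 * C * exp (pi / 2 * ((cmod z)\<^sup>2 - \<bar>Im (z\<^sup>2)\<bar>))" if z: "1 \<le> \<bar>Im (z\<^sup>2)\<bar>" for z
    proof -
      have a: "1 \<le> cmod (z\<^sup>2 - 1)" using z abs_Im_le_cmod[of "z\<^sup>2 - 1"] by simp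
      have "1/2 \<le> pi / 2 * \<bar>Im (z\<^sup>2)\<bar>"
        using z pi_ge_two mult_mono[of 1 "pi/2" 1 "\<bar>Im (z\<^sup>2)\<bar>"] by simp
      then have "exp (pi / 2 * \<bar>Im (z\<^sup>2)\<bar>) / 4 \<le> cmod (sin (of_real pi * z\<^sup>2 / 2))"
        using cmod_sin_ge_exp[of "of_real pi * z\<^sup>2 / 2"] unfolding imr by (simp add: abs_mult)
      then have "cmod (h z) * (exp (pi / 2 * \<bar>Im (z\<^sup>2)\<bar>) / 4) \<le> 2 * (C * exp (pi / 2 * (cmod z)\<^sup>2))"
        using q[OF a] by (meson mult_left_mono norm_ge_zero order_trans)
      then show ?thesis unfolding right_diff_distrib exp_diff by (simp add: field_simps)
    qed
    show "cmod (h z) \<le> 8 * C * exp (pi / 2 * (cmod z)\<^sup>2)"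
      if n: "1 \<le> n" "\<bar>Re (z\<^sup>2)\<bar> = 2 * real n + 1" for z n
    proof -
      have "1 \<le> \<bar>Re (z\<^sup>2 - 1)\<bar>" using n by auto
      then have a: "1 \<le> cmod (z\<^sup>2 - 1)" using abs_Re_le_cmod[of "z\<^sup>2 - 1"] by linarith
      have "cos (2 * Re (of_real pi * z\<^sup>2 / 2)) = cos (pi * \<bar>Re (z\<^sup>2)\<bar>)"
        unfolding imr by (simp add: abs_if)
      also have "\<dots> = cos (2 * real n * pi + pi)" unfolding n(2) by (simp add: algebra_simps)
      also have "\<dots> = - 1" by (simp add: cos_add)
      finally have "1 \<le> cmod (sin (of_real pi * z\<^sup>2 / 2))" by (rule cmod_sin_ge_1)
      then have "cmod (h z) * 1 \<le> 2 * (C * exp (pi / 2 * (cmod z)\<^sup>2))"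
        using q[OF a] by (meson mult_left_mono norm_ge_zero order_trans)
      also have "\<dots> \<le> 8 * C * exp (pi / 2 * (cmod z)\<^sup>2)" using C by simp
      finally show ?thesis by simp
    qed
  qed
  then obtain c where c: "\<And>z. h z = c" by (auto simp: constant_on_def)
  \<comment> \<open>The points \<open>x + \<i> x\<close> have \<open>z\<^sup>2 = 2 \<i> x\<^sup>2\<close>, so there the sine is as large as the growth bound.\<close>
  have "cmod c / 8 \<le> cmod (F (Complex x x)) * exp (- pi * x\<^sup>2)" if x: "1 \<le> x" for x
  proof -
    define z where "z = Complex x x"
    have z2: "z\<^sup>2 = \<i> * of_real (2 * x\<^sup>2)"
      by (simp add: z_def complex_eq_iff power2_eq_square)
    have x2: "1 \<le> x\<^sup>2" using x by simp
    have cz: "cmod (z\<^sup>2) = 2 * x\<^sup>2" unfolding z2 by (simp add: norm_mult norm_power)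
    have "Im (z\<^sup>2) = 2 * x\<^sup>2" unfolding z2 by simp
    then have "2 * x\<^sup>2 \<le> cmod (z\<^sup>2 - 1)"
      using abs_Im_le_cmod[of "z\<^sup>2 - 1"] by simp
    have "1/2 \<le> pi / 2 * (2 * x\<^sup>2)" using x2 pi_ge_two mult_mono[of 1 "pi/2" 1 "2 * x\<^sup>2"] by simp
    then have s: "exp (pi * x\<^sup>2) / 4 \<le> cmod (sin (of_real pi * z\<^sup>2 / 2))"
      using cmod_sin_ge_exp[of "of_real pi * z\<^sup>2 / 2"] unfolding imr \<open>Im (z\<^sup>2) = _\<close> by simp
    have "F z * z\<^sup>2 = c * (sin (of_real pi * z\<^sup>2 / 2) * (z\<^sup>2 - 1))"
      unfolding h(2) c using E(2)[of z] by (simp add: ac_simps)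
    then have "cmod (F z) * (2 * x\<^sup>2) = cmod c * (cmod (sin (of_real pi * z\<^sup>2 / 2)) * cmod (z\<^sup>2 - 1))"
      by (metis cz norm_mult)
    also have "\<dots> \<ge> cmod c * (exp (pi * x\<^sup>2) / 4 * (2 * x\<^sup>2))"
      using s \<open>2 * x\<^sup>2 \<le> cmod (z\<^sup>2 - 1)\<close> by (intro mult_left_mono mult_mono) auto
    finally have "cmod c * (exp (pi * x\<^sup>2) / 4) * (2 * x\<^sup>2) \<le> cmod (F z) * (2 * x\<^sup>2)" by (simp add: ac_simps)
    then have "cmod c * (exp (pi * x\<^sup>2) / 4) \<le> cmod (F z)" using x by simp
    then have "cmod c / 4 \<le> cmod (F z) * exp (- pi * x\<^sup>2)" by (simp add: exp_minus field_simps)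
    moreover have "cmod c / 8 \<le> cmod c / 4" by simp
    ultimately show ?thesis unfolding z_def by linarith
  qed
  then have "\<forall>\<^sub>F x in at_top. cmod c / 8 \<le> cmod (F (Complex x x)) * exp (- pi * x\<^sup>2)"
    by (intro eventually_at_top_linorderI)
  then have "cmod c / 8 \<le> 0"
    using diag tendsto_lowerbound trivial_limit_at_top_linorder by blast
  then show ?thesis using h(2) c by simp
qed

section \<open>Square-integrable functions as a Hilbert space\<close>

definition L2_inner :: "(real \<Rightarrow> complex) \<Rightarrow> (real \<Rightarrow> complex) \<Rightarrow> complex" where
  "L2_inner f h = (LINT t|lborel. f t * cnj (h t))"

lemma L2_measurable [measurable_dest]: "f \<in> L2 \<Longrightarrow> f \<in> borel_measurable borel"
  by (simp add: L2_def)

lemma cnj_measurable [measurable]: "cnj \<in> borel_measurable borel"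
  by (intro borel_measurable_continuous_onI continuous_intros)

lemma L2_integrable_sq: "f \<in> L2 \<Longrightarrow> integrable lborel (\<lambda>t. (cmod (f t))\<^sup>2)"
  by (simp add: L2_def)

lemma L2_norm_nonneg [simp]: "0 \<le> L2_norm f"
  by (simp add: L2_norm_def)

lemma L2_norm_sq: "(L2_norm f)\<^sup>2 = (LINT t|lborel. (cmod (f t))\<^sup>2)"
  by (simp add: L2_norm_def)

lemma L2_integrable_mult:
  assumes "f \<in> L2" "h \<in> L2"
  shows "integrable lborel (\<lambda>t. cmod (f t) * cmod (h t))"
proof (rule Bochner_Integration.integrable_bound)
  show "integrable lborel (\<lambda>t. (cmod (f t))\<^sup>2 + (cmod (h t))\<^sup>2)"
    using assms by (intro Bochner_Integration.integrable_add L2_integrable_sq)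
  show "(\<lambda>t. cmod (f t) * cmod (h t)) \<in> borel_measurable lborel"
    using assms by measurable
  have "cmod (f t) * cmod (h t) \<le> (cmod (f t))\<^sup>2 + (cmod (h t))\<^sup>2" for t
    using sum_squares_bound[of "cmod (f t)" "cmod (h t)"] mult_nonneg_nonneg[OF norm_ge_zero norm_ge_zero, of "f t" "h t"]
    by linarith
  then show "AE t in lborel. norm (cmod (f t) * cmod (h t)) \<le> norm ((cmod (f t))\<^sup>2 + (cmod (h t))\<^sup>2)"
    by (simp add: abs_mult)
qed

lemma L2_integrable_inner:
  assumes "f \<in> L2" "h \<in> L2"
  shows "integrable lborel (\<lambda>t. f t * cnj (h t))"
proof (rule Bochner_Integration.integrable_bound[OF L2_integrable_mult[OF assms]])
  note [measurable] = assms
  show "(\<lambda>t. f t * cnj (h t)) \<in> borel_measurable lborel" by measurable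
qed (simp add: norm_mult)

lemma L2_Cauchy_Schwarz:
  assumes "f \<in> L2" "h \<in> L2"
  shows "(LINT t|lborel. cmod (f t) * cmod (h t)) \<le> L2_norm f * L2_norm h"
proof -
  note [measurable] = assms
  define I where "I = (LINT t|lborel. cmod (f t) * cmod (h t))"
  have sq: "(\<integral>\<^sup>+t. ennreal ((cmod (k t))\<^sup>2) \<partial>lborel) = ennreal ((L2_norm k)\<^sup>2)" if "k \<in> L2" for k
    unfolding L2_norm_sq using L2_integrable_sq[OF that]
    by (subst nn_integral_eq_integral[symmetric]) auto
  have "(\<integral>\<^sup>+t. ennreal (cmod (f t)) * ennreal (cmod (h t)) \<partial>lborel) = ennreal I"
    unfolding I_def using L2_integrable_mult[OF assms]
    by (subst nn_integral_eq_integral[symmetric]) (auto simp: ennreal_mult)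
  moreover have "(\<integral>\<^sup>+t. ennreal (cmod (f t)) * ennreal (cmod (h t)) \<partial>lborel)\<^sup>2
      \<le> (\<integral>\<^sup>+t. (ennreal (cmod (f t)))\<^sup>2 \<partial>lborel) * (\<integral>\<^sup>+t. (ennreal (cmod (h t)))\<^sup>2 \<partial>lborel)"
    by (rule Cauchy_Schwarz_nn_integral) measurable
  moreover have "0 \<le> I" unfolding I_def by simp
  ultimately have "ennreal (I\<^sup>2) \<le> ennreal ((L2_norm f)\<^sup>2) * ennreal ((L2_norm h)\<^sup>2)"
    by (simp add: sq[OF assms(1)] sq[OF assms(2)] ennreal_power)
  then have "I\<^sup>2 \<le> (L2_norm f * L2_norm h)\<^sup>2"
    by (simp add: ennreal_mult[symmetric] power_mult_distrib)
  then show ?thesis unfolding I_def[symmetric] by (rule power2_le_imp_le) simp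
qed

lemma cmod_L2_inner_le:
  assumes "f \<in> L2" "h \<in> L2"
  shows "cmod (L2_inner f h) \<le> L2_norm f * L2_norm h"
proof -
  have "cmod (L2_inner f h) \<le> (LINT t|lborel. cmod (f t * cnj (h t)))"
    unfolding L2_inner_def by (rule integral_norm_bound)
  then show ?thesis using L2_Cauchy_Schwarz[OF assms] by (simp add: norm_mult)
qed

lemma L2_add_scaled:
  assumes "f \<in> L2" "h \<in> L2"
  shows "f + cscale c h \<in> L2"
    and "(L2_norm (f + cscale c h))\<^sup>2 = (L2_norm f)\<^sup>2 + 2 * Re (cnj c * L2_inner f h) + (cmod c)\<^sup>2 * (L2_norm h)\<^sup>2"
proof -
  note [measurable] = assms
  have eq: "(cmod ((f + cscale c h) t))\<^sup>2 = (cmod (f t))\<^sup>2 + 2 * Re (cnj c * (f t * cnj (h t))) + (cmod c)\<^sup>2 * (cmod (h t))\<^sup>2" for t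
    unfolding cmod_power2 by (simp add: cscale_def power2_eq_square algebra_simps)
  have int: "integrable lborel (\<lambda>t. Re (cnj c * (f t * cnj (h t))))"
    by (intro integrable_Re integrable_mult_right L2_integrable_inner assms)
  show "f + cscale c h \<in> L2"
    unfolding L2_def mem_Collect_eq eq
    by (intro conjI Bochner_Integration.integrable_add integrable_mult_right int L2_integrable_sq assms)
       (simp add: cscale_def plus_fun_def)
  have "(LINT t|lborel. Re (cnj c * (f t * cnj (h t)))) = Re (cnj c * L2_inner f h)"
    unfolding L2_inner_def
    by (subst integral_Re) (auto intro!: integrable_mult_right L2_integrable_inner assms)
  moreover have "(LINT t|lborel. (cmod (f t))\<^sup>2 + 2 * Re (cnj c * (f t * cnj (h t))) + (cmod c)\<^sup>2 * (cmod (h t))\<^sup>2)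
      = (LINT t|lborel. (cmod (f t))\<^sup>2) + 2 * (LINT t|lborel. Re (cnj c * (f t * cnj (h t))))
        + (cmod c)\<^sup>2 * (LINT t|lborel. (cmod (h t))\<^sup>2)"
    by (intro has_bochner_integral_integral_eq has_bochner_integral_add has_bochner_integral_mult_right
        has_bochner_integral_integrable int L2_integrable_sq assms)
  ultimately show "(L2_norm (f + cscale c h))\<^sup>2 = (L2_norm f)\<^sup>2 + 2 * Re (cnj c * L2_inner f h) + (cmod c)\<^sup>2 * (L2_norm h)\<^sup>2"
    unfolding L2_norm_sq eq by metis
qed

lemma cscale_1 [simp]: "cscale 1 f = f" and cscale_m1: "cscale (- 1) f = - f"
  by (auto simp: cscale_def fun_eq_iff)

lemma L2_zero: "0 \<in> L2"
  by (simp add: L2_def zero_fun_def)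

lemma subspace_L2: "cfun.subspace L2"
proof (rule cfun.subspaceI)
  show "0 \<in> L2" by (rule L2_zero)
  show "x + y \<in> L2" if "x \<in> L2" "y \<in> L2" for x y
    using L2_add_scaled(1)[OF that, of 1] by simp
  show "cscale c x \<in> L2" if "x \<in> L2" for c x
    using L2_add_scaled(1)[OF L2_zero that, of c] by simp
qed

lemmas L2_add = cfun.subspace_add[OF subspace_L2]
  and L2_diff = cfun.subspace_diff[OF subspace_L2]
  and L2_scale = cfun.subspace_scale[OF subspace_L2]

lemma L2_norm_triangle:
  assumes "f \<in> L2" "h \<in> L2"
  shows "L2_norm (f + h) \<le> L2_norm f + L2_norm h"
proof -
  have "Re (L2_inner f h) \<le> L2_norm f * L2_norm h"
    using complex_Re_le_cmod cmod_L2_inner_le[OF assms] order_trans by blast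
  then have "(L2_norm (f + h))\<^sup>2 \<le> (L2_norm f + L2_norm h)\<^sup>2"
    using L2_add_scaled(2)[OF assms, of 1] by (simp add: power2_eq_square algebra_simps)
  then show ?thesis by (rule power2_le_imp_le) simp
qed

lemma L2_norm_scale_sq: "(L2_norm (cscale c f))\<^sup>2 = (cmod c)\<^sup>2 * (L2_norm f)\<^sup>2"
  by (simp add: L2_norm_sq cscale_def norm_mult power_mult_distrib)

lemma L2_norm_minus_commute: "L2_norm (f - h) = L2_norm (h - f)"
  by (simp add: L2_norm_def norm_minus_commute)

lemma L2_parallelogram:
  assumes "f \<in> L2" "h \<in> L2"
  shows "(L2_norm (f + h))\<^sup>2 + (L2_norm (f - h))\<^sup>2 = 2 * (L2_norm f)\<^sup>2 + 2 * (L2_norm h)\<^sup>2"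
  using L2_add_scaled(2)[OF assms, of 1] L2_add_scaled(2)[OF assms, of "-1"]
  by (simp add: cscale_m1)

text \<open>
  Completeness of \<open>L2\<close>, for a sequence that converges geometrically: such a sequence converges
  almost everywhere because a weighted sum of the squared increments is integrable, and
  Fatou's lemma transfers the norm bound to the limit.
\<close>

lemma L2_limit_of_geometric_Cauchy:
  fixes v :: "nat \<Rightarrow> real \<Rightarrow> complex"
  assumes v: "\<And>n. v n \<in> L2" and rapid: "\<And>m n. m \<le> n \<Longrightarrow> L2_norm (v n - v m) \<le> (1/2)^m"
  obtains e where "e \<in> L2" "\<And>m. L2_norm (e - v m) \<le> (1/2)^m"
proof -
  note [measurable] = v
  define e where "e t = lim (\<lambda>n. v n t)" for t
  have em [measurable]: "e \<in> borel_measurable borel"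
    unfolding e_def by measurable
  define a where "a n t = (cmod (v (Suc n) t - v n t))\<^sup>2" for n t
  have nn: "(\<integral>\<^sup>+t. ennreal ((cmod (v n t - v m t))\<^sup>2) \<partial>lborel) = ennreal ((L2_norm (v n - v m))\<^sup>2)" for n m
    unfolding L2_norm_sq using L2_integrable_sq[OF L2_diff[OF v[of n] v[of m]]]
    by (subst nn_integral_eq_integral[symmetric]) auto
  have "(\<integral>\<^sup>+t. (\<Sum>n. ennreal (2^n * a n t)) \<partial>lborel) = (\<Sum>n. \<integral>\<^sup>+t. ennreal (2^n * a n t) \<partial>lborel)"
    unfolding a_def by (rule nn_integral_suminf) measurable
  also have "\<dots> \<le> (\<Sum>n. ennreal ((1/2)^n))"
  proof (rule suminf_le)
    fix n
    have "(\<integral>\<^sup>+t. ennreal (2^n * a n t) \<partial>lborel) = ennreal (2^n) * ennreal ((L2_norm (v (Suc n) - v n))\<^sup>2)"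
      unfolding nn[symmetric] a_def by (subst nn_integral_cmult[symmetric]) (auto simp: ennreal_mult)
    also have "\<dots> = ennreal (2^n * (L2_norm (v (Suc n) - v n))\<^sup>2)" by (simp add: ennreal_mult)
    also have "\<dots> \<le> ennreal (2^n * ((1/2)^n)\<^sup>2)"
      using rapid[of n "Suc n"] by (intro ennreal_leI mult_left_mono power_mono) auto
    also have "2^n * ((1/2)^n)\<^sup>2 = (1/2::real)^n"
      by (simp add: power2_eq_square power_mult_distrib[symmetric] mult.assoc[symmetric])
    finally show "(\<integral>\<^sup>+t. ennreal (2^n * a n t) \<partial>lborel) \<le> ennreal ((1/2)^n)" .
  qed auto
  also have "\<dots> = ennreal (\<Sum>n. (1/2)^n)" by (intro suminf_ennreal2) auto
  finally have "(\<integral>\<^sup>+t. (\<Sum>n. ennreal (2^n * a n t)) \<partial>lborel) \<le> ennreal (\<Sum>n. (1/2)^n)" .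
  from order.strict_trans1[OF this ennreal_less_top]
  have "AE t in lborel. (\<Sum>n. ennreal (2^n * a n t)) \<noteq> \<infinity>"
    by (intro nn_integral_noteq_infinite) (auto simp: a_def)
  then have lim: "AE t in lborel. (\<lambda>n. v n t) \<longlonglongrightarrow> e t"
  proof eventually_elim
    fix t assume "(\<Sum>n. ennreal (2^n * a n t)) \<noteq> \<infinity>"
    then have s: "summable (\<lambda>n. 2^n * a n t)"
      by (intro summable_suminf_not_top) (auto simp: a_def)
    have "summable (\<lambda>n. v (Suc n) t - v n t)"
    proof (rule summable_comparison_test')
      show "summable (\<lambda>n. 2^n * a n t + (1/2)^n)" using s by (intro summable_add) auto
      show "norm (v (Suc n) t - v n t) \<le> 2^n * a n t + (1/2)^n" if "0 \<le> n" for n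
      proof -
        define x where "x = cmod (v (Suc n) t - v n t)"
        \<comment> \<open>Trading the increment for its weighted square: \<open>x \<le> 2^n x\<^sup>2 + 2^(- n)\<close>, the last term being summable.\<close>
        have "0 \<le> (2^n * x - 1)\<^sup>2" "0 \<le> 2^n * x" by (simp_all add: x_def)
        then have "2^n * x \<le> 2^n * (2^n * x\<^sup>2) + 1"
          by (simp add: power2_eq_square algebra_simps)
        also have "\<dots> = 2^n * (2^n * x\<^sup>2 + (1/2)^n)"
          by (simp add: distrib_left power_mult_distrib[symmetric])
        finally show ?thesis unfolding a_def x_def[symmetric] by simp
      qed
    qed
    then have "convergent (\<lambda>n. v n t - v 0 t)"
      using sum_lessThan_telescope[of "\<lambda>n. v n t"] by (simp add: summable_iff_convergent)
    then have "convergent (\<lambda>n. v n t)"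
      using convergent_diff_const_right_iff[of "\<lambda>n. v n t" "v 0 t"] by simp
    then show "(\<lambda>n. v n t) \<longlonglongrightarrow> e t" by (simp add: e_def convergent_LIMSEQ_iff)
  qed
  have bound: "(\<integral>\<^sup>+t. ennreal ((cmod (e t - v m t))\<^sup>2) \<partial>lborel) \<le> ennreal (((1/2)^m)\<^sup>2)" for m
  proof -
    have "(\<integral>\<^sup>+t. ennreal ((cmod (e t - v m t))\<^sup>2) \<partial>lborel)
        = (\<integral>\<^sup>+t. liminf (\<lambda>n. ennreal ((cmod (v n t - v m t))\<^sup>2)) \<partial>lborel)"
      using lim
    proof (intro nn_integral_cong_AE, eventually_elim)
      fix t assume "(\<lambda>n. v n t) \<longlonglongrightarrow> e t"
      then have "(\<lambda>n. ennreal ((cmod (v n t - v m t))\<^sup>2)) \<longlonglongrightarrow> ennreal ((cmod (e t - v m t))\<^sup>2)"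
        by (intro tendsto_intros)
      then show "ennreal ((cmod (e t - v m t))\<^sup>2) = liminf (\<lambda>n. ennreal ((cmod (v n t - v m t))\<^sup>2))"
        using lim_imp_Liminf[OF sequentially_bot] by metis
    qed
    also have "\<dots> \<le> liminf (\<lambda>n. \<integral>\<^sup>+t. ennreal ((cmod (v n t - v m t))\<^sup>2) \<partial>lborel)"
      by (rule nn_integral_liminf) measurable
    also have "\<dots> \<le> liminf (\<lambda>n::nat. ennreal (((1/2)^m)\<^sup>2))"
      unfolding nn using rapid
      by (intro Liminf_mono eventually_mono[OF eventually_ge_at_top[of m]] ennreal_leI power_mono) auto
    also have "\<dots> = ennreal (((1/2)^m)\<^sup>2)" by (simp add: Liminf_const)
    finally show ?thesis .
  qed
  have d: "e - v m \<in> L2" for m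
  proof -
    have "integrable lborel (\<lambda>t. (cmod (e t - v m t))\<^sup>2)"
    proof (rule integrableI_bounded)
      show "(\<integral>\<^sup>+t. ennreal (norm ((cmod (e t - v m t))\<^sup>2)) \<partial>lborel) < \<infinity>"
        using le_less_trans[OF bound[of m] ennreal_less_top] by simp
    qed simp
    then show ?thesis by (simp add: L2_def fun_diff_def)
  qed
  show ?thesis
  proof
    show "e \<in> L2" using L2_add[OF d[of 0] v[of 0]] by simp
    show "L2_norm (e - v m) \<le> (1/2)^m" for m
    proof -
      have "ennreal ((L2_norm (e - v m))\<^sup>2) = (\<integral>\<^sup>+t. ennreal ((cmod (e t - v m t))\<^sup>2) \<partial>lborel)"
        unfolding L2_norm_sq using L2_integrable_sq[OF d[of m]]
        by (subst nn_integral_eq_integral[symmetric]) auto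
      then have "ennreal ((L2_norm (e - v m))\<^sup>2) \<le> ennreal (((1/2)^m)\<^sup>2)" using bound[of m] by metis
      then have "(L2_norm (e - v m))\<^sup>2 \<le> ((1/2)^m)\<^sup>2" by (subst (asm) ennreal_le_iff) auto
      then show ?thesis by (rule power2_le_imp_le) simp
    qed
  qed
qed

text \<open>
  The projection theorem: a minimizing sequence for the distance of \<open>f\<close> to \<open>V\<close> is Cauchy by the
  parallelogram law, and the residual of its limit is orthogonal to \<open>V\<close>.
\<close>

lemma L2_closure_eq_if_orthogonal_trivial:
  assumes V: "cfun.subspace V" "V \<subseteq> L2"
    and orth: "\<And>e. e \<in> L2 \<Longrightarrow> (\<And>v. v \<in> V \<Longrightarrow> L2_inner e v = 0) \<Longrightarrow> L2_norm e = 0"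
  shows "L2_closure V = L2"
proof
  show "L2_closure V \<subseteq> L2" by (auto simp: L2_closure_def)
  show "L2 \<subseteq> L2_closure V"
  proof
    fix f assume f: "f \<in> L2"
    define d where "d = (INF v\<in>V. (L2_norm (f - v))\<^sup>2)"
    have bdd: "bdd_below ((\<lambda>v. (L2_norm (f - v))\<^sup>2) ` V)" by (rule bdd_belowI[of _ 0]) auto
    have "0 \<in> V" using V(1) by (rule cfun.subspace_0)
    have d_le: "d \<le> (L2_norm (f - v))\<^sup>2" if "v \<in> V" for v
      unfolding d_def using bdd that by (rule cINF_lower)
    have "0 \<le> d" unfolding d_def using \<open>0 \<in> V\<close> by (intro cINF_greatest) auto
    have "\<exists>v\<in>V. (L2_norm (f - v))\<^sup>2 < d + (1/4)^(Suc n)" for n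
    proof -
      have "Inf ((\<lambda>v. (L2_norm (f - v))\<^sup>2) ` V) < d + (1/4)^(Suc n)" unfolding d_def by simp
      then show ?thesis using cInf_lessD[of "(\<lambda>v. (L2_norm (f - v))\<^sup>2) ` V"] \<open>0 \<in> V\<close> by blast
    qed
    then obtain v where v: "\<And>n. v n \<in> V" "\<And>n. (L2_norm (f - v n))\<^sup>2 < d + (1/4)^(Suc n)" by metis
    have vL: "v n \<in> L2" for n using v(1) V(2) by blast
    \<comment> \<open>The midpoint of \<open>v n\<close> and \<open>v m\<close> lies in \<open>V\<close>, hence is at squared distance at least \<open>d\<close> from \<open>f\<close>.\<close>
    have rapid: "L2_norm (v n - v m) \<le> (1/2)^m" if "m \<le> n" for m n
    proof -
      have mid: "cscale (1/2) (v n + v m) \<in> V"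
        using V(1) v(1) by (intro cfun.subspace_scale cfun.subspace_add)
      have "(f - v n) + (f - v m) = cscale 2 (f - cscale (1/2) (v n + v m))"
        by (auto simp: cscale_def fun_eq_iff algebra_simps)
      then have "(L2_norm ((f - v n) + (f - v m)))\<^sup>2 = 4 * (L2_norm (f - cscale (1/2) (v n + v m)))\<^sup>2"
        by (simp only: L2_norm_scale_sq) simp
      also have "\<dots> \<ge> 4 * d" using d_le[OF mid] by simp
      finally have 1: "4 * d \<le> (L2_norm ((f - v n) + (f - v m)))\<^sup>2" .
      have "(f - v n) - (f - v m) = v m - v n" by simp
      then have "(L2_norm ((f - v n) + (f - v m)))\<^sup>2 + (L2_norm (v n - v m))\<^sup>2
          = 2 * (L2_norm (f - v n))\<^sup>2 + 2 * (L2_norm (f - v m))\<^sup>2"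
        using L2_parallelogram[OF L2_diff[OF f vL[of n]] L2_diff[OF f vL[of m]]]
          L2_norm_minus_commute by metis
      moreover have "(1/4::real)^(Suc n) \<le> (1/4)^(Suc m)"
        using that by (intro power_decreasing) auto
      ultimately have "(L2_norm (v n - v m))\<^sup>2 \<le> 4 * (1/4)^(Suc m)"
        using 1 v(2)[of n] v(2)[of m] by linarith
      also have "\<dots> = ((1/2)^m)\<^sup>2" by (simp add: power2_eq_square flip: power_mult_distrib)
      finally show ?thesis by (rule power2_le_imp_le) simp
    qed
    obtain p where p: "p \<in> L2" "\<And>m. L2_norm (p - v m) \<le> (1/2)^m"
      using L2_limit_of_geometric_Cauchy[of v] vL rapid by blast
    define e where "e = f - p"
    have e: "e \<in> L2" unfolding e_def by (intro L2_diff f p)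
    have half: "(\<lambda>n. (1/2::real)^n) \<longlonglongrightarrow> 0" by (intro LIMSEQ_power_zero) simp
    have e_le: "L2_norm e \<le> sqrt d"
    proof (rule tendsto_lowerbound)
      show "(\<lambda>n. sqrt (d + (1/4)^(Suc n)) + (1/2)^n) \<longlonglongrightarrow> sqrt d"
        using half LIMSEQ_Suc[OF LIMSEQ_power_zero[of "1/4::real"]]
        by (auto intro!: tendsto_eq_intros)
      have "L2_norm e \<le> sqrt (d + (1/4)^(Suc n)) + (1/2)^n" for n
      proof -
        have "e = (f - v n) + (v n - p)" by (simp add: e_def)
        then have "L2_norm e \<le> L2_norm (f - v n) + L2_norm (v n - p)"
          using L2_norm_triangle[OF L2_diff[OF f vL[of n]] L2_diff[OF vL[of n] p(1)]] by metis
        moreover have "L2_norm (f - v n) \<le> sqrt (d + (1/4)^(Suc n))"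
          using v(2)[of n] by (intro real_le_rsqrt) simp
        ultimately show ?thesis using p(2)[of n] L2_norm_minus_commute[of p "v n"] by linarith
      qed
      then show "\<forall>\<^sub>F n in sequentially. L2_norm e \<le> sqrt (d + (1/4)^(Suc n)) + (1/2)^n" by simp
    qed simp
    have le_e: "sqrt d \<le> L2_norm (e - u)" if u: "u \<in> V" for u
    proof -
      have uL: "u \<in> L2" using u V by blast
      have "sqrt d \<le> L2_norm (e - u) + (1/2)^n" for n
      proof -
        have "v n + u \<in> V" using V(1) v(1) u by (intro cfun.subspace_add)
        then have "sqrt d \<le> L2_norm (f - (v n + u))"
          using d_le by (intro real_le_lsqrt \<open>0 \<le> d\<close>) auto
        also have "f - (v n + u) = (e - u) + (p - v n)" by (simp add: e_def)
        also have "L2_norm \<dots> \<le> L2_norm (e - u) + L2_norm (p - v n)"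
          by (intro L2_norm_triangle L2_diff e uL p vL)
        finally show ?thesis using p(2)[of n] by linarith
      qed
      moreover have "(\<lambda>n. L2_norm (e - u) + (1/2)^n) \<longlonglongrightarrow> L2_norm (e - u)"
        using half by (auto intro!: tendsto_eq_intros)
      ultimately show ?thesis by (intro LIMSEQ_le_const[where X="\<lambda>n. L2_norm (e - u) + (1/2)^n"]) auto
    qed
    have "L2_norm e = 0"
    proof (rule orth[OF e])
      fix u assume u: "u \<in> V"
      then have uL: "u \<in> L2" using V by blast
      define a where "a = L2_inner e u"
      \<comment> \<open>Moving from \<open>e\<close> by \<open>s a u\<close> cannot shorten it; the linear term in \<open>s\<close> must therefore vanish.\<close>
      have *: "2 * (cmod a)\<^sup>2 \<le> s * ((cmod a)\<^sup>2 * (L2_norm u)\<^sup>2)" if s: "0 < s" for s :: real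
      proof -
        define c where "c = - (of_real s * a)"
        have "e + cscale c u = e - cscale (of_real s * a) u"
          by (auto simp: c_def cscale_def fun_eq_iff)
        then have "L2_norm e \<le> L2_norm (e + cscale c u)"
          using le_e[OF cfun.subspace_scale[OF V(1) u]] e_le by (metis order_trans)
        then have "(L2_norm e)\<^sup>2 \<le> (L2_norm (e + cscale c u))\<^sup>2"
          by (intro power_mono) auto
        also have "\<dots> = (L2_norm e)\<^sup>2 + 2 * Re (cnj c * a) + (cmod c)\<^sup>2 * (L2_norm u)\<^sup>2"
          unfolding a_def by (rule L2_add_scaled(2)[OF e uL])
        also have "Re (cnj c * a) = - s * (cmod a)\<^sup>2"
          unfolding cmod_power2 by (simp add: c_def power2_eq_square algebra_simps)
        also have "(cmod c)\<^sup>2 = s\<^sup>2 * (cmod a)\<^sup>2"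
          by (simp add: c_def norm_mult power_mult_distrib)
        finally have "s * (2 * (cmod a)\<^sup>2) \<le> s * (s * ((cmod a)\<^sup>2 * (L2_norm u)\<^sup>2))"
          by (simp add: power2_eq_square algebra_simps)
        then show ?thesis using s by simp
      qed
      have "((\<lambda>s. s * ((cmod a)\<^sup>2 * (L2_norm u)\<^sup>2)) \<longlongrightarrow> 0 * ((cmod a)\<^sup>2 * (L2_norm u)\<^sup>2)) (at_right 0)"
        by (intro tendsto_intros)
      then have "2 * (cmod a)\<^sup>2 \<le> 0 * ((cmod a)\<^sup>2 * (L2_norm u)\<^sup>2)"
        by (rule tendsto_lowerbound) (auto intro: eventually_mono[OF eventually_at_right_less] *)
      then show "L2_inner e u = 0" by (simp add: a_def)
    qed
    show "f \<in> L2_closure V"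
      unfolding L2_closure_def
    proof (intro CollectI conjI f allI impI)
      fix \<epsilon> :: real assume "0 < \<epsilon>"
      then obtain n where n: "(1/2)^n < \<epsilon>" using real_arch_pow_inv[of \<epsilon> "1/2"] by auto
      have "f - v n = e + (p - v n)" by (simp add: e_def)
      then have "L2_norm (f - v n) \<le> L2_norm e + L2_norm (p - v n)"
        using L2_norm_triangle[OF e L2_diff[OF p(1) vL[of n]]] by metis
      then have "L2_norm (f - v n) < \<epsilon>" using n p(2)[of n] \<open>L2_norm e = 0\<close> by linarith
      then show "\<exists>h\<in>V. L2_norm (f - h) < \<epsilon>" using v(1) by blast
    qed
  qed
qed

section \<open>The Gaussian Bargmann transform\<close>

definition gauss_kernel :: "complex \<Rightarrow> real \<Rightarrow> complex" where
  "gauss_kernel z t = exp (2 * of_real pi * of_real t * z - of_real (pi * t\<^sup>2))"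

lemma cmod_gauss_kernel: "cmod (gauss_kernel z t) = exp (2 * pi * Re z * t - pi * t\<^sup>2)"
  unfolding gauss_kernel_def norm_exp_eq_Re by (simp add: power2_eq_square algebra_simps)

lemma gauss_kernel_measurable [measurable]: "gauss_kernel z \<in> borel_measurable borel"
  unfolding gauss_kernel_def by measurable

text \<open>
  The Bargmann transform in the usual normalization is, up to a constant, this function times
  \<open>exp (- \<pi> z\<^sup>2 / 2)\<close>. Without that factor, division by \<open>z - a\<close> takes a simpler form.
\<close>

definition bargmann :: "(real \<Rightarrow> complex) \<Rightarrow> complex \<Rightarrow> complex" where
  "bargmann f z = (LINT t|lborel. f t * gauss_kernel z t)"

text \<open>
  The domain of the transform: it has to contain \<open>L2\<close> as well as the bounded functions, because
  chirps are not square-integrable.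
\<close>

definition gauss_tame :: "(real \<Rightarrow> complex) \<Rightarrow> bool" where
  "gauss_tame f \<longleftrightarrow> f \<in> borel_measurable borel \<and>
     (\<forall>r. integrable lborel (\<lambda>t. cmod (f t) * exp (2 * pi * r * t - pi * t\<^sup>2)))"

lemma gauss_tame_measurable [measurable_dest]: "gauss_tame f \<Longrightarrow> f \<in> borel_measurable borel"
  by (simp add: gauss_tame_def)

lemma gaussian_integral:
  assumes "0 < a"
  shows "integrable lborel (\<lambda>t. exp (2 * a * r * t - a * t\<^sup>2))"
    and "(LINT t|lborel. exp (2 * a * r * t - a * t\<^sup>2)) = exp (a * r\<^sup>2) * sqrt (pi / a)"
proof -
  define s where "s = sqrt (1 / (2 * a))"
  have s: "0 < s" "s\<^sup>2 = 1 / (2 * a)" using assms by (auto simp: s_def)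
  have eq: "exp (2 * a * r * t - a * t\<^sup>2) = exp (a * r\<^sup>2) * sqrt (pi / a) * normal_density r s t" for t
  proof -
    have "2 * pi * s\<^sup>2 = pi / a" using assms by (simp add: s(2))
    moreover have "2 * s\<^sup>2 = 1 / a" using assms by (simp add: s(2))
    then have "- (t - r)\<^sup>2 / (2 * s\<^sup>2) = 2 * a * r * t - a * t\<^sup>2 - a * r\<^sup>2"
      by (simp add: power2_eq_square algebra_simps)
    ultimately show ?thesis using assms by (simp add: normal_density_def exp_diff)
  qed
  show "integrable lborel (\<lambda>t. exp (2 * a * r * t - a * t\<^sup>2))"
    unfolding eq by (intro integrable_mult_right integrable_normal_density s)
  show "(LINT t|lborel. exp (2 * a * r * t - a * t\<^sup>2)) = exp (a * r\<^sup>2) * sqrt (pi / a)"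
    unfolding eq using integral_normal_density[OF s(1)] by simp
qed

lemma gauss_tame_bounded:
  assumes [measurable]: "f \<in> borel_measurable borel" and C: "\<And>t. cmod (f t) \<le> C"
  shows "gauss_tame f"
  unfolding gauss_tame_def
proof (intro conjI allI)
  fix r
  show "integrable lborel (\<lambda>t. cmod (f t) * exp (2 * pi * r * t - pi * t\<^sup>2))"
  proof (rule Bochner_Integration.integrable_bound)
    show "integrable lborel (\<lambda>t. C * exp (2 * pi * r * t - pi * t\<^sup>2))"
      by (intro integrable_mult_right gaussian_integral) simp
    have "0 \<le> C" using C[of 0] norm_ge_zero order_trans by blast
    then show "AE t in lborel. norm (cmod (f t) * exp (2 * pi * r * t - pi * t\<^sup>2)) \<le> norm (C * exp (2 * pi * r * t - pi * t\<^sup>2))"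
      using C by (auto simp: abs_mult intro!: mult_right_mono)
  qed measurable
qed (fact assms)

lemma gaussian_window_L2:
  shows "(\<lambda>t. of_real (exp (2 * pi * r * t - pi * t\<^sup>2))) \<in> L2"
    and "L2_norm (\<lambda>t. of_real (exp (2 * pi * r * t - pi * t\<^sup>2))) \<le> exp (pi * r\<^sup>2)"
proof -
  have eq: "(cmod (of_real (exp (2 * pi * r * t - pi * t\<^sup>2))))\<^sup>2 = exp (2 * (2 * pi) * r * t - (2 * pi) * t\<^sup>2)" for t
    by (simp add: exp_double[symmetric] algebra_simps)
  show "(\<lambda>t. of_real (exp (2 * pi * r * t - pi * t\<^sup>2))) \<in> L2"
    unfolding L2_def mem_Collect_eq eq by (intro conjI gaussian_integral) auto
  have "(LINT t|lborel. exp (2 * (2 * pi) * r * t - (2 * pi) * t\<^sup>2)) = exp ((2 * pi) * r\<^sup>2) * sqrt (pi / (2 * pi))"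
    by (rule gaussian_integral) simp
  also have "\<dots> \<le> exp ((2 * pi) * r\<^sup>2) * 1"
    by (intro mult_left_mono) auto
  also have "\<dots> = (exp (pi * r\<^sup>2))\<^sup>2" by (simp add: exp_double[symmetric] algebra_simps)
  finally show "L2_norm (\<lambda>t. of_real (exp (2 * pi * r * t - pi * t\<^sup>2))) \<le> exp (pi * r\<^sup>2)"
    unfolding L2_norm_def eq by (intro real_le_lsqrt) auto
qed

lemma gauss_tame_L2:
  assumes "f \<in> L2"
  shows "gauss_tame f"
  using L2_integrable_mult[OF assms gaussian_window_L2(1)] L2_measurable[OF assms]
  by (simp add: gauss_tame_def)

lemma bargmann_integrable:
  assumes "gauss_tame f"
  shows "integrable lborel (\<lambda>t. f t * gauss_kernel z t)"
proof (rule Bochner_Integration.integrable_bound)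
  note [measurable] = assms
  show "integrable lborel (\<lambda>t. cmod (f t) * exp (2 * pi * Re z * t - pi * t\<^sup>2))"
    using assms by (simp add: gauss_tame_def)
  show "(\<lambda>t. f t * gauss_kernel z t) \<in> borel_measurable lborel"
    by measurable
  show "AE t in lborel. norm (f t * gauss_kernel z t)
      \<le> norm (cmod (f t) * exp (2 * pi * Re z * t - pi * t\<^sup>2))"
    by (simp add: norm_mult cmod_gauss_kernel)
qed

lemma bargmann_add_scaled:
  assumes "gauss_tame f" "gauss_tame h"
  shows "bargmann (f + cscale c h) z = bargmann f z + c * bargmann h z"
proof -
  have "(LINT t|lborel. f t * gauss_kernel z t + c * (h t * gauss_kernel z t)) = bargmann f z + c * bargmann h z"
    unfolding bargmann_def
    by (intro has_bochner_integral_integral_eq has_bochner_integral_add has_bochner_integral_mult_right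
        has_bochner_integral_integrable bargmann_integrable assms)
  then show ?thesis by (simp add: bargmann_def cscale_def algebra_simps)
qed

text \<open>
  The kernel is expanded in powers of \<open>z\<close> and integrated term by term; the absolute series sums to
  \<open>exp (2 \<pi> r \<bar>t\<bar>)\<close>, which is dominated by the kernels at \<open>r\<close> and \<open>- r\<close> together.
\<close>

lemma bargmann_entire:
  assumes f: "gauss_tame f"
  shows "bargmann f holomorphic_on UNIV"
proof -
  note [measurable] = f
  define T where "T z n t = f t * of_real (exp (- pi * t\<^sup>2)) * (2 * of_real pi * of_real t * z)^n / fact n" for z n t
  define a where "a n = (LINT t|lborel. f t * of_real (exp (- pi * t\<^sup>2)) * (2 * of_real pi * of_real t)^n / fact n)" for n
  have "(\<lambda>n. a n * (z - 0)^n) sums bargmann f z" for z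
  proof -
    define r where "r = cmod z"
    define G where "G t = cmod (f t) * exp (2 * pi * r * t - pi * t\<^sup>2) + cmod (f t) * exp (2 * pi * (- r) * t - pi * t\<^sup>2)" for t
    have G: "integrable lborel G" unfolding G_def
      using f unfolding gauss_tame_def by (intro Bochner_Integration.integrable_add) blast+
    have nT: "norm (T z n t) = cmod (f t) * exp (- pi * t\<^sup>2) * ((2 * pi * r * \<bar>t\<bar>)^n / fact n)" for n t
      by (simp add: T_def r_def norm_mult norm_divide norm_power power_mult_distrib ac_simps)
    have nTs: "(\<lambda>n. norm (T z n t)) sums (cmod (f t) * exp (- pi * t\<^sup>2) * exp (2 * pi * r * \<bar>t\<bar>))" for t
      unfolding nT using exp_converges[of "2 * pi * r * \<bar>t\<bar>"]
      by (intro sums_mult) (simp add: divide_inverse mult.commute)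
    have le: "cmod (f t) * exp (- pi * t\<^sup>2) * exp (2 * pi * r * \<bar>t\<bar>) \<le> G t" for t
    proof -
      have "- pi * t\<^sup>2 + 2 * pi * r * \<bar>t\<bar> = 2 * pi * r * t - pi * t\<^sup>2
          \<or> - pi * t\<^sup>2 + 2 * pi * r * \<bar>t\<bar> = 2 * pi * (- r) * t - pi * t\<^sup>2"
        by (auto simp: abs_if)
      then show ?thesis unfolding G_def mult.assoc exp_add[symmetric] by auto
    qed
    have sumle: "(\<Sum>n<N. norm (T z n t)) \<le> G t" for N t
      using sum_le_suminf[OF sums_summable[OF nTs[of t]], of "{..<N}"] sums_unique[OF nTs[of t]] le[of t] by simp
    have Tint: "integrable lborel (T z n)" for n
    proof (rule Bochner_Integration.integrable_bound[OF G])
      show "T z n \<in> borel_measurable lborel" unfolding T_def by measurable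
      have "norm (T z n t) \<le> norm (G t)" for t
        using sumle[where N="Suc n" and t=t] sum_nonneg[of "{..<n}" "\<lambda>n. norm (T z n t)"] by simp
      then show "AE t in lborel. norm (T z n t) \<le> norm (G t)" by simp
    qed
    have "(\<lambda>n. integral\<^sup>L lborel (T z n)) sums (LINT t|lborel. (\<Sum>n. T z n t))"
    proof (rule sums_integral)
      show "integrable lborel (T z n)" for n by (rule Tint)
      show "AE t in lborel. summable (\<lambda>n. norm (T z n t))" using nTs sums_summable by blast
      show "summable (\<lambda>n. LINT t|lborel. norm (T z n t))"
      proof (rule summableI_nonneg_bounded)
        show "(\<Sum>n<N. LINT t|lborel. norm (T z n t)) \<le> integral\<^sup>L lborel G" for N
        proof -
          have "(\<Sum>n<N. LINT t|lborel. norm (T z n t)) = (LINT t|lborel. (\<Sum>n<N. norm (T z n t)))"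
            by (rule Bochner_Integration.integral_sum[symmetric]) (intro integrable_norm Tint)
          also have "\<dots> \<le> integral\<^sup>L lborel G"
            by (intro integral_mono Bochner_Integration.integrable_sum integrable_norm Tint G sumle)
          finally show ?thesis .
        qed
      qed simp
    qed
    moreover have "(\<Sum>n. T z n t) = f t * gauss_kernel z t" for t
    proof -
      have "(\<lambda>n. f t * of_real (exp (- pi * t\<^sup>2)) * ((2 * of_real pi * of_real t * z)^n / fact n)) sums
          (f t * of_real (exp (- pi * t\<^sup>2)) * exp (2 * of_real pi * of_real t * z))"
        using exp_converges[of "2 * of_real pi * of_real t * z"]
        by (intro sums_mult) (simp add: scaleR_conv_of_real divide_inverse mult.commute)
      moreover have "f t * of_real (exp (- pi * t\<^sup>2)) * exp (2 * of_real pi * of_real t * z)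
          = f t * gauss_kernel z t"
        unfolding gauss_kernel_def exp_diff by (simp add: exp_minus divide_inverse flip: exp_of_real)
      ultimately show ?thesis by (simp add: T_def sums_iff)
    qed
    moreover have "integral\<^sup>L lborel (T z n) = a n * (z - 0)^n" for n
      unfolding a_def T_def integral_mult_left_zero[symmetric]
      by (intro Bochner_Integration.integral_cong) (simp_all add: power_mult_distrib)
    ultimately show ?thesis unfolding bargmann_def by simp
  qed
  then have "bargmann f holomorphic_on ball 0 r" for r
    by (intro power_series_holomorphic[where a=a]) auto
  then show ?thesis
    by (metis (no_types, opaque_lifting) UNIV_I holomorphic_on_open open_ball open_UNIV mem_ball_0 gt_ex holomorphic_on_def field_differentiable_at_within at_within_open)
qed

lemma bargmann_growth:
  assumes "f \<in> L2"
  shows "cmod (bargmann f z) \<le> L2_norm f * exp (pi * (Re z)\<^sup>2)"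
proof -
  have "cmod (bargmann f z) \<le> (LINT t|lborel. cmod (f t) * cmod (of_real (exp (2 * pi * Re z * t - pi * t\<^sup>2))))"
    unfolding bargmann_def
    by (rule order_trans[OF integral_norm_bound]) (simp add: norm_mult cmod_gauss_kernel)
  also have "\<dots> \<le> L2_norm f * L2_norm (\<lambda>t. of_real (exp (2 * pi * Re z * t - pi * t\<^sup>2)))"
    by (intro L2_Cauchy_Schwarz assms gaussian_window_L2)
  also have "\<dots> \<le> L2_norm f * exp (pi * (Re z)\<^sup>2)"
    by (intro mult_left_mono gaussian_window_L2) simp
  finally show ?thesis .
qed

text \<open>
  By Cauchy-Schwarz the square of the normalized transform is at most the integral of \<open>\<bar>f\<bar>\<^sup>2\<close> against
  the Gaussian centred at \<open>x\<close>, and this tends to \<open>0\<close> by dominated convergence.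
\<close>

lemma bargmann_decay:
  assumes f: "f \<in> L2"
  shows "((\<lambda>x. cmod (bargmann f (Complex x (y x))) * exp (- pi * x\<^sup>2)) \<longlongrightarrow> 0) at_top"
proof -
  note [measurable] = f
  define J where "J x = (LINT t|lborel. (cmod (f t))\<^sup>2 * exp (- pi * (t - x)\<^sup>2))" for x
  have int: "integrable lborel (\<lambda>t. (cmod (f t))\<^sup>2 * exp (- pi * (t - x)\<^sup>2))" for x
    by (rule Bochner_Integration.integrable_bound[OF L2_integrable_sq[OF f]])
       (auto intro!: mult_left_le)
  have J: "(J \<longlongrightarrow> (LINT t::real|lborel. 0::real)) at_top"
    unfolding J_def
  proof (rule integral_dominated_convergence_at_top[where w="\<lambda>t. (cmod (f t))\<^sup>2"])
    show "integrable lborel (\<lambda>t. (cmod (f t))\<^sup>2)" by (rule L2_integrable_sq[OF f])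
    show "\<forall>\<^sub>F x in at_top. AE t in lborel. norm ((cmod (f t))\<^sup>2 * exp (- pi * (t - x)\<^sup>2)) \<le> (cmod (f t))\<^sup>2"
      by (intro always_eventually allI AE_I2) (simp add: mult_left_le)
    have "((\<lambda>x. exp (- pi * (t - x)\<^sup>2)) \<longlongrightarrow> 0) at_top" for t :: real
      by real_asymp
    then show "AE t in lborel. ((\<lambda>x. (cmod (f t))\<^sup>2 * exp (- pi * (t - x)\<^sup>2)) \<longlongrightarrow> 0) at_top"
      by (auto intro!: tendsto_mult_right_zero)
  qed auto
  have le: "cmod (bargmann f (Complex x (y x))) * exp (- pi * x\<^sup>2) \<le> sqrt (J x)" for x
  proof -
    \<comment> \<open>A square root of the Gaussian window: one copy stays with \<open>f\<close>, the other one has norm \<open>1\<close>.\<close>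
    define g where "g t = exp (- pi / 2 * (t - x)\<^sup>2)" for t
    have g2: "(g t)\<^sup>2 = exp (- pi * (t - x)\<^sup>2)" for t
      by (simp add: g_def exp_double[symmetric])
    have g2': "(g t)\<^sup>2 = exp (2 * pi * x * t - pi * t\<^sup>2) * exp (- pi * x\<^sup>2)" for t
      unfolding g2 exp_add[symmetric] by (simp add: power2_eq_square algebra_simps)
    have gm [measurable]: "g \<in> borel_measurable borel" unfolding g_def by measurable
    have gL: "(\<lambda>t. of_real (g t)) \<in> L2" "L2_norm (\<lambda>t. of_real (g t)) = 1"
    proof -
      have "integrable lborel (\<lambda>t. (g t)\<^sup>2)" "(LINT t|lborel. (g t)\<^sup>2) = 1"
        unfolding g2' using gaussian_integral[of pi x] by (simp_all add: exp_minus field_simps)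
      then show "(\<lambda>t. of_real (g t)) \<in> L2" "L2_norm (\<lambda>t. of_real (g t)) = 1"
        by (auto simp: L2_def L2_norm_def)
    qed
    have fgL: "(\<lambda>t. f t * of_real (g t)) \<in> L2" "L2_norm (\<lambda>t. f t * of_real (g t)) = sqrt (J x)"
      using int[of x] by (auto simp: L2_def L2_norm_def J_def norm_mult power_mult_distrib g2)
    have "cmod (bargmann f (Complex x (y x))) \<le> (LINT t|lborel. cmod (f t) * exp (2 * pi * x * t - pi * t\<^sup>2))"
      unfolding bargmann_def
      by (rule order_trans[OF integral_norm_bound]) (simp add: norm_mult cmod_gauss_kernel)
    then have "cmod (bargmann f (Complex x (y x))) * exp (- pi * x\<^sup>2)
        \<le> (LINT t|lborel. cmod (f t) * exp (2 * pi * x * t - pi * t\<^sup>2)) * exp (- pi * x\<^sup>2)"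
      by (intro mult_right_mono) auto
    also have "\<dots> = (LINT t|lborel. cmod (f t * of_real (g t)) * cmod (of_real (g t)))"
      unfolding integral_mult_left_zero[symmetric]
      using g2' by (intro Bochner_Integration.integral_cong) (auto simp: norm_mult power2_eq_square[symmetric] mult.assoc)
    also have "\<dots> \<le> sqrt (J x) * 1"
      using L2_Cauchy_Schwarz[OF fgL(1) gL(1)] fgL(2) gL(2) by simp
    finally show ?thesis by simp
  qed
  have "((\<lambda>x. sqrt (J x)) \<longlongrightarrow> sqrt 0) at_top"
    using J by (intro tendsto_intros) simp
  then have lim: "((\<lambda>x. sqrt (J x)) \<longlongrightarrow> 0) at_top" by simp
  show ?thesis
  proof (rule tendsto_sandwich[OF _ _ tendsto_const lim])
    show "\<forall>\<^sub>F x in at_top. 0 \<le> cmod (bargmann f (Complex x (y x))) * exp (- pi * x\<^sup>2)"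
      by (intro always_eventually allI mult_nonneg_nonneg) auto
    show "\<forall>\<^sub>F x in at_top. cmod (bargmann f (Complex x (y x))) * exp (- pi * x\<^sup>2) \<le> sqrt (J x)"
      by (intro always_eventually allI le)
  qed
qed

section \<open>Injectivity of the transform\<close>

text \<open>
  The positive and the negative part of \<open>u\<close> have the same total mass; normalized, they are
  densities of two probability measures with the same characteristic function.
\<close>

lemma AE_eq_0_if_fourier_eq_0_real:
  fixes u :: "real \<Rightarrow> real"
  assumes u: "integrable lborel u"
    and fourier: "\<And>\<omega>. (LINT t|lborel. u t *\<^sub>R iexp (\<omega> * t)) = 0"
  shows "AE t in lborel. u t = 0"
proof -
  note [measurable] = borel_measurable_integrable[OF u]
  define p where "p t = max (u t) 0" for t
  define q where "q t = max (- u t) 0" for t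
  have [measurable]: "p \<in> borel_measurable borel" "q \<in> borel_measurable borel"
    unfolding p_def q_def by measurable
  have upq: "u t = p t - q t" for t by (auto simp: p_def q_def)
  have p: "integrable lborel p" unfolding p_def using u by simp
  have q: "integrable lborel q" unfolding q_def using u by simp
  have int: "integrable lborel (\<lambda>t. r t *\<^sub>R iexp (\<omega> * t))" if r: "integrable lborel r" for r :: "real \<Rightarrow> real" and \<omega>
  proof (rule Bochner_Integration.integrable_bound[OF r])
    show "(\<lambda>t. r t *\<^sub>R iexp (\<omega> * t)) \<in> borel_measurable lborel"
      using borel_measurable_integrable[OF r] by measurable
  qed simp
  have eq: "(LINT t|lborel. p t *\<^sub>R iexp (\<omega> * t)) = (LINT t|lborel. q t *\<^sub>R iexp (\<omega> * t))" for \<omega>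
    using fourier[of \<omega>] int[OF p, of \<omega>] int[OF q, of \<omega>]
    unfolding upq scaleR_diff_left by (simp add: Bochner_Integration.integral_diff)
  define m where "m = integral\<^sup>L lborel p"
  have "of_real (integral\<^sup>L lborel p) = (of_real (integral\<^sup>L lborel q) :: complex)"
    using eq[of 0] p q by (simp add: scaleR_conv_of_real)
  then have m: "integral\<^sup>L lborel q = m" by (simp add: m_def)
  have "0 \<le> m" unfolding m_def by (rule integral_nonneg_AE) (simp add: p_def)
  show ?thesis
  proof (cases "m = 0")
    case True
    have "AE t in lborel. p t = 0"
      using integral_nonneg_eq_0_iff_AE[OF p] True by (simp add: m_def p_def)
    moreover have "AE t in lborel. q t = 0"
      using integral_nonneg_eq_0_iff_AE[OF q] True m by (simp add: q_def)
    ultimately show ?thesis by eventually_elim (simp add: upq)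
  next
    case False
    then have mpos: "0 < m" using \<open>0 \<le> m\<close> by simp
    define D where "D r = density lborel (\<lambda>t. ennreal (r t / m))" for r :: "real \<Rightarrow> real"
    have D: "real_distribution (D r) \<and> char (D r) = (\<lambda>\<omega>. (LINT t|lborel. r t *\<^sub>R iexp (\<omega> * t)) / of_real m)"
      if r: "integrable lborel r" "\<And>t. 0 \<le> r t" "integral\<^sup>L lborel r = m" for r
    proof
      note [measurable] = borel_measurable_integrable[OF r(1)]
      have "(\<integral>\<^sup>+t. ennreal (r t / m) \<partial>lborel) = ennreal (LINT t|lborel. r t / m)"
        using r mpos by (intro nn_integral_eq_integral) auto
      also have "(LINT t|lborel. r t / m) = 1" using r(3) mpos by simp
      finally have "emeasure (D r) (space (D r)) = 1"
        unfolding D_def by (simp add: emeasure_density)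
      then have "prob_space (D r)" by (rule prob_spaceI)
      then show "real_distribution (D r)"
        by (intro real_distribution.intro real_distribution_axioms.intro) (simp_all add: D_def)
      show "char (D r) = (\<lambda>\<omega>. (LINT t|lborel. r t *\<^sub>R iexp (\<omega> * t)) / of_real m)"
      proof
        fix \<omega>
        have "char (D r) \<omega> = (LINT t|lborel. (r t / m) *\<^sub>R iexp (\<omega> * t))"
          unfolding char_def D_def using r(2) mpos by (subst integral_density) auto
        also have "\<dots> = (LINT t|lborel. (r t *\<^sub>R iexp (\<omega> * t)) / of_real m)"
          by (intro Bochner_Integration.integral_cong) (auto simp: scaleR_conv_of_real)
        finally show "char (D r) \<omega> = (LINT t|lborel. r t *\<^sub>R iexp (\<omega> * t)) / of_real m"
          by simp
      qed
    qed
    have Dp: "real_distribution (D p) \<and> char (D p) = (\<lambda>\<omega>. (LINT t|lborel. p t *\<^sub>R iexp (\<omega> * t)) / of_real m)"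
      by (rule D) (auto simp: p m_def, simp add: p_def)
    have Dq: "real_distribution (D q) \<and> char (D q) = (\<lambda>\<omega>. (LINT t|lborel. q t *\<^sub>R iexp (\<omega> * t)) / of_real m)"
      by (rule D) (auto simp: q m, simp add: q_def)
    have "D p = D q"
      using Dp Dq eq by (intro Levy_uniqueness) auto
    then have "AE t in lborel. ennreal (p t / m) = ennreal (q t / m)"
      unfolding D_def by (intro sigma_finite_measure.density_unique[OF lborel.sigma_finite_measure_axioms]) auto
    then show ?thesis
    proof eventually_elim
      fix t assume "ennreal (p t / m) = ennreal (q t / m)"
      then have "p t / m = q t / m"
        using mpos by (subst (asm) ennreal_inj) (auto simp: p_def q_def)
      then show "u t = 0" using mpos by (simp add: upq)
    qed
  qed
qed

text \<open>
  On the imaginary axis the transform is the Fourier transform of \<open>f(t) exp (- \<pi> t\<^sup>2)\<close>. For its real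
  and imaginary parts one also needs the Fourier transform of the conjugate, which vanishes too.
\<close>

lemma bargmann_injective:
  assumes f: "gauss_tame f" and zero: "\<And>z. bargmann f z = 0"
  shows "AE t in lborel. f t = 0"
proof -
  note [measurable] = f
  define \<phi> where "\<phi> t = f t * gauss_kernel 0 t" for t
  have \<phi>: "integrable lborel \<phi>" unfolding \<phi>_def by (rule bargmann_integrable[OF f])
  have [measurable]: "\<phi> \<in> borel_measurable borel" unfolding \<phi>_def by measurable
  have int: "integrable lborel (\<lambda>t. \<phi> t * iexp (\<omega> * t))" for \<omega>
    by (rule Bochner_Integration.integrable_bound[OF \<phi>]) (auto simp: norm_mult)
  have fourier: "(LINT t|lborel. \<phi> t * iexp (\<omega> * t)) = 0" for \<omega>
  proof -
    have "gauss_kernel (\<i> * of_real \<omega> / (2 * of_real pi)) t = gauss_kernel 0 t * iexp (\<omega> * t)" for t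
      unfolding gauss_kernel_def exp_add[symmetric] by (simp add: ac_simps)
    then have "f t * gauss_kernel (\<i> * of_real \<omega> / (2 * of_real pi)) t = \<phi> t * iexp (\<omega> * t)" for t
      by (simp add: \<phi>_def)
    then show ?thesis using zero[of "\<i> * of_real \<omega> / (2 * of_real pi)"] by (simp add: bargmann_def)
  qed
  have fourier': "(LINT t|lborel. cnj (\<phi> t) * iexp (\<omega> * t)) = 0" for \<omega>
  proof -
    have "(LINT t|lborel. cnj (\<phi> t) * iexp (\<omega> * t)) = (LINT t|lborel. cnj (\<phi> t * iexp (- \<omega> * t)))"
      by (simp add: exp_cnj)
    also have "\<dots> = cnj (LINT t|lborel. \<phi> t * iexp (- \<omega> * t))"
      by (rule integral_bounded_linear[OF bounded_linear_cnj int])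
    finally show ?thesis unfolding fourier by simp
  qed
  have int': "integrable lborel (\<lambda>t. cnj (\<phi> t) * iexp (\<omega> * t))" for \<omega>
    by (rule Bochner_Integration.integrable_bound[OF \<phi>]) (auto simp: norm_mult)
  have "AE t in lborel. Re (\<phi> t) = 0"
  proof (rule AE_eq_0_if_fourier_eq_0_real)
    show "integrable lborel (\<lambda>t. Re (\<phi> t))" using \<phi> by simp
    fix \<omega>
    have "Re (\<phi> t) *\<^sub>R iexp (\<omega> * t) = (\<phi> t * iexp (\<omega> * t) + cnj (\<phi> t) * iexp (\<omega> * t)) / 2" for t
      by (simp add: scaleR_conv_of_real distrib_right[symmetric] complex_add_cnj)
    then show "(LINT t|lborel. Re (\<phi> t) *\<^sub>R iexp (\<omega> * t)) = 0"
      by (simp only: integral_divide_zero Bochner_Integration.integral_add[OF int int'] fourier fourier') simp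
  qed
  moreover have "AE t in lborel. Im (\<phi> t) = 0"
  proof (rule AE_eq_0_if_fourier_eq_0_real)
    show "integrable lborel (\<lambda>t. Im (\<phi> t))" using \<phi> by simp
    fix \<omega>
    have "Im (\<phi> t) *\<^sub>R iexp (\<omega> * t) = (\<phi> t * iexp (\<omega> * t) - cnj (\<phi> t) * iexp (\<omega> * t)) / (2 * \<i>)" for t
    proof -
      have "of_real (Im (\<phi> t)) = (\<phi> t - cnj (\<phi> t)) / (2 * \<i>)" by (simp add: complex_eq_iff)
      then show ?thesis by (simp add: scaleR_conv_of_real left_diff_distrib)
    qed
    then show "(LINT t|lborel. Im (\<phi> t) *\<^sub>R iexp (\<omega> * t)) = 0"
      by (simp only: integral_divide_zero Bochner_Integration.integral_diff[OF int int'] fourier fourier') simp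
  qed
  ultimately show ?thesis
  proof eventually_elim
    fix t assume "Re (\<phi> t) = 0" "Im (\<phi> t) = 0"
    then have "\<phi> t = 0" by (simp add: complex_eq_iff)
    then show "f t = 0" by (simp add: \<phi>_def gauss_kernel_def)
  qed
qed

section \<open>Dividing a transform by a linear factor\<close>

text \<open>
  Dropping the linear term bounds the integral by \<open>1\<close>. Replacing the integrand by
  \<open>2 \<pi> (v + b)\<close> times itself, which is an exact derivative with total integral \<open>1\<close>, gives the
  factor \<open>b\<close>.
\<close>

lemma half_gaussian_tail:
  fixes b :: real
  assumes "0 \<le> b"
  defines "e \<equiv> \<lambda>v. indicator {0<..} v * exp (- pi * v\<^sup>2 - 2 * pi * b * v)"
  shows "integrable lborel e" and "(1 + b) * integral\<^sup>L lborel e \<le> 2"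
proof -
  have [measurable]: "e \<in> borel_measurable borel" unfolding e_def by measurable
  have g: "integrable lborel (\<lambda>v. exp (- pi * v\<^sup>2))" "(LINT v|lborel. exp (- pi * v\<^sup>2)) = 1"
    using gaussian_integral[of pi 0] by simp_all
  have e0: "0 \<le> e v" for v by (simp add: e_def)
  have le: "e v \<le> exp (- pi * v\<^sup>2)" for v
    using assms(1) by (auto simp: e_def indicator_def)
  show int: "integrable lborel e"
    by (rule Bochner_Integration.integrable_bound[OF g(1)]) (use e0 le in auto)
  have 1: "integral\<^sup>L lborel e \<le> 1"
    using integral_mono[OF int g(1) le] g(2) by simp
  have "(\<integral>\<^sup>+v. ennreal (2 * pi * (v + b) * exp (- pi * v\<^sup>2 - 2 * pi * b * v)) * indicator {0..} v \<partial>lborel)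
      = ennreal (0 - (- exp (- pi * 0\<^sup>2 - 2 * pi * b * 0)))"
  proof (rule nn_integral_FTC_atLeast)
    have "((\<lambda>v. exp (- pi * v\<^sup>2 - 2 * pi * b * v)) \<longlongrightarrow> 0) at_top"
    proof (rule tendsto_sandwich[OF _ _ tendsto_const])
      show "((\<lambda>v. exp (- pi * v\<^sup>2)) \<longlongrightarrow> 0) at_top" by real_asymp
      show "\<forall>\<^sub>F v in at_top. exp (- pi * v\<^sup>2 - 2 * pi * b * v) \<le> exp (- pi * v\<^sup>2)"
        using eventually_ge_at_top[of 0] by eventually_elim (simp add: assms(1))
    qed simp
    from tendsto_minus[OF this] show "((\<lambda>v. - exp (- pi * v\<^sup>2 - 2 * pi * b * v)) \<longlongrightarrow> 0) at_top" by simp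
  qed (use assms(1) in \<open>auto intro!: derivative_eq_intros simp: algebra_simps\<close>)
  moreover have "(\<integral>\<^sup>+v. ennreal (2 * pi * b * e v) \<partial>lborel)
      \<le> (\<integral>\<^sup>+v. ennreal (2 * pi * (v + b) * exp (- pi * v\<^sup>2 - 2 * pi * b * v)) * indicator {0..} v \<partial>lborel)"
    by (intro nn_integral_mono) (auto simp: e_def indicator_def intro!: ennreal_leI mult_right_mono)
  ultimately have "(LINT v|lborel. 2 * pi * b * e v) \<le> 1"
    by (intro integral_real_bounded) auto
  then have "pi * 2 * (b * integral\<^sup>L lborel e) \<le> 1" by (simp add: ac_simps)
  moreover have "0 \<le> b * integral\<^sup>L lborel e" using assms(1) e0 by (intro mult_nonneg_nonneg integral_nonneg) auto
  then have "1 * (b * integral\<^sup>L lborel e) \<le> pi * 2 * (b * integral\<^sup>L lborel e)"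
    using pi_ge_two by (intro mult_right_mono) auto
  ultimately show "(1 + b) * integral\<^sup>L lborel e \<le> 2" using 1 by (simp add: distrib_right)
qed

lemma gaussian_tail_right:
  assumes "x \<le> t"
  shows "(1 + \<bar>t - x\<bar>) * (LINT s|lborel. indicator {t<..} s * exp (2 * pi * x * s - pi * s\<^sup>2)) \<le> 2 * exp (2 * pi * x * t - pi * t\<^sup>2)"
proof -
  have "(LINT s|lborel. indicator {t<..} s * exp (2 * pi * x * s - pi * s\<^sup>2))
      = (LINT v|lborel. indicator {t<..} (t + 1 * v) * exp (2 * pi * x * (t + 1 * v) - pi * (t + 1 * v)\<^sup>2))"
    by (subst lborel_integral_real_affine[where c = 1 and t = t]) auto
  also have "\<dots> = (LINT v|lborel. exp (2 * pi * x * t - pi * t\<^sup>2) * (indicator {0<..} v * exp (- pi * v\<^sup>2 - 2 * pi * (t - x) * v)))"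
    by (intro Bochner_Integration.integral_cong) (auto simp: indicator_def exp_add[symmetric] power2_eq_square algebra_simps)
  also have "\<dots> = exp (2 * pi * x * t - pi * t\<^sup>2) * (LINT v|lborel. indicator {0<..} v * exp (- pi * v\<^sup>2 - 2 * pi * (t - x) * v))"
    by simp
  finally have eq: "(LINT s|lborel. indicator {t<..} s * exp (2 * pi * x * s - pi * s\<^sup>2)) = \<dots>" .
  have "(1 + (t - x)) * (LINT v|lborel. indicator {0<..} v * exp (- pi * v\<^sup>2 - 2 * pi * (t - x) * v)) \<le> 2"
    using half_gaussian_tail(2)[of "t - x"] assms by simp
  then have "exp (2 * pi * x * t - pi * t\<^sup>2) * ((1 + (t - x)) * (LINT v|lborel. indicator {0<..} v * exp (- pi * v\<^sup>2 - 2 * pi * (t - x) * v))) \<le> exp (2 * pi * x * t - pi * t\<^sup>2) * 2"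
    by (intro mult_left_mono) auto
  then show ?thesis unfolding eq using assms by (simp add: ac_simps)
qed

lemma gaussian_tail_left:
  assumes "t \<le> x"
  shows "(1 + \<bar>t - x\<bar>) * (LINT s|lborel. indicator {..<t} s * exp (2 * pi * x * s - pi * s\<^sup>2)) \<le> 2 * exp (2 * pi * x * t - pi * t\<^sup>2)"
proof -
  have "(LINT s|lborel. indicator {..<t} s * exp (2 * pi * x * s - pi * s\<^sup>2))
      = (LINT s|lborel. indicator {..<t} (0 + -1 * s) * exp (2 * pi * x * (0 + -1 * s) - pi * (0 + -1 * s)\<^sup>2))"
    by (subst lborel_integral_real_affine[where c = "-1" and t = 0]) auto
  also have "\<dots> = (LINT s|lborel. indicator {- t<..} s * exp (2 * pi * (- x) * s - pi * s\<^sup>2))"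
    by (intro Bochner_Integration.integral_cong) (auto simp: indicator_def)
  finally show ?thesis using gaussian_tail_right[of "- x" "- t"] assms by (simp add: abs_minus_commute)
qed

lemma decaying_in_L2:
  fixes f :: "real \<Rightarrow> complex"
  assumes [measurable]: "f \<in> borel_measurable borel" and K: "\<And>t. cmod (f t) * (1 + \<bar>t - x\<bar>) \<le> K"
  shows "f \<in> L2"
proof -
  have "integrable lborel (\<lambda>t::real. inverse (1 + t\<^sup>2))"
    using integrable_inverse_1_plus_square by (simp add: set_integrable_def)
  from lborel_integrable_real_affine[OF this, of 1 "- x"]
  have int: "integrable lborel (\<lambda>t. K\<^sup>2 * inverse (1 + (t - x)\<^sup>2))" by simp
  have "(cmod (f t))\<^sup>2 \<le> K\<^sup>2 * inverse (1 + (t - x)\<^sup>2)" for t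
  proof -
    have "(cmod (f t))\<^sup>2 * (1 + (t - x)\<^sup>2) \<le> (cmod (f t))\<^sup>2 * (1 + \<bar>t - x\<bar>)\<^sup>2"
      by (intro mult_left_mono) (auto simp: power2_eq_square algebra_simps)
    also have "\<dots> = (cmod (f t) * (1 + \<bar>t - x\<bar>))\<^sup>2" by (simp add: power_mult_distrib)
    also have "\<dots> \<le> K\<^sup>2" using K by (intro power_mono) auto
    finally show ?thesis by (simp add: field_simps add_pos_nonneg)
  qed
  then have "integrable lborel (\<lambda>t. (cmod (f t))\<^sup>2)"
    by (intro Bochner_Integration.integrable_bound[OF int]) auto
  then show ?thesis by (simp add: L2_def)
qed

text \<open>
  The quotient \<open>f\<close> solves \<open>f' = 2 \<pi> (t - a) f - 2 \<pi> c\<close>, so that the exact derivative of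
  \<open>f\<close> times \<open>gauss_kernel z\<close> is \<open>2 \<pi> ((z - a) f - c)\<close> times \<open>gauss_kernel z\<close>; integrating it over the line
  gives the claim. The solution is obtained from the primitive \<open>u\<close> of \<open>c\<close> times
  \<open>gauss_kernel a\<close>. As the total integral of the latter is \<open>0\<close>, \<open>u\<close> can be written as an integral
  over either half line, and the Gaussian tail on the appropriate side gives the decay of \<open>f\<close>.
\<close>

lemma bargmann_divide:
  fixes c :: "real \<Rightarrow> complex"
  assumes cont: "continuous_on UNIV c" and C: "\<And>t. cmod (c t) \<le> C" and zero: "bargmann c a = 0"
  obtains f K where "continuous_on UNIV f" "\<And>t. cmod (f t) * (1 + \<bar>t - Re a\<bar>) \<le> K"
    "\<And>z. (z - a) * bargmann f z = bargmann c z"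
proof -
  have cm [measurable]: "c \<in> borel_measurable borel"
    using cont by (intro borel_measurable_continuous_onI)
  have tame: "gauss_tame c" using cm C by (rule gauss_tame_bounded)
  have "0 \<le> C" using C[of 0] norm_ge_zero order_trans by blast
  define w where "w t = c t * gauss_kernel a t" for t
  have wm [measurable]: "w \<in> borel_measurable borel" unfolding w_def by measurable
  have wint: "integrable lborel w" unfolding w_def by (rule bargmann_integrable[OF tame])
  have w0: "integral\<^sup>L lborel w = 0" using zero by (simp add: bargmann_def w_def[abs_def])
  have gk: "continuous_on UNIV (gauss_kernel z)" for z
    unfolding gauss_kernel_def by (intro continuous_intros)
  have wcont: "continuous_on UNIV w" unfolding w_def by (intro continuous_intros cont gk)
  have wi: "integrable lborel (\<lambda>s. indicator A s *\<^sub>R w s)" if "A \<in> sets borel" for A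
    using wint that by (intro integrable_mult_indicator) auto
  \<comment> \<open>The primitive of \<open>w\<close> that vanishes at both ends of the line.\<close>
  define u where "u t = (LINT s|lborel. indicator {..<t} s *\<^sub>R w s)" for t
  have u_right: "u t = - (LINT s|lborel. indicator {t<..} s *\<^sub>R w s)" for t
  proof -
    have "u t + (LINT s|lborel. indicator {t<..} s *\<^sub>R w s) = (LINT s|lborel. indicator {..<t} s *\<^sub>R w s + indicator {t<..} s *\<^sub>R w s)"
      unfolding u_def by (intro Bochner_Integration.integral_add[symmetric] wi) auto
    also have "\<dots> = integral\<^sup>L lborel w"
      by (rule integral_cong_AE) (use AE_lborel_singleton[of t] in \<open>auto simp: indicator_def elim!: eventually_mono\<close>)
    finally show ?thesis by (simp add: w0 add_eq_0_iff)
  qed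
  have u_diff: "u t - u s = (LINT r|lborel. indicator {s..t} r *\<^sub>R w r)" if "s \<le> t" for s t
  proof -
    have "u t - u s = (LINT r|lborel. indicator {..<t} r *\<^sub>R w r - indicator {..<s} r *\<^sub>R w r)"
      unfolding u_def by (intro Bochner_Integration.integral_diff[symmetric] wi) auto
    also have "\<dots> = (LINT r|lborel. indicator {s..t} r *\<^sub>R w r)"
      by (rule integral_cong_AE) (use AE_lborel_singleton[of t] that in \<open>auto simp: indicator_def elim!: eventually_mono\<close>)
    finally show ?thesis .
  qed
  obtain F where F: "\<And>t. (F has_vector_derivative w t) (at t)"
    using einterval_antiderivative[of "-\<infinity>" "\<infinity>" w] wcont
    by (auto simp: continuous_on_eq_continuous_at)
  have "u t - u s = F t - F s" if "s \<le> t" for s t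
    unfolding u_diff[OF that]
    by (rule integral_FTC_Icc[OF that])
       (auto intro: has_vector_derivative_at_within[OF F] continuous_on_subset[OF wcont])
  then have "u t = F t + (u 0 - F 0)" for t
    by (cases "0 \<le> t") (force simp: algebra_simps)+
  then have u_eq: "u = (\<lambda>t. F t + (u 0 - F 0))" by blast
  have u_deriv: "(u has_vector_derivative w t) (at t)" for t
    by (subst u_eq) (auto intro!: derivative_eq_intros F)
  then have ucont: "continuous_on UNIV u"
    using has_vector_derivative_continuous by (fastforce simp: continuous_on_eq_continuous_at)
  have nw: "cmod (w s) \<le> C * exp (2 * pi * Re a * s - pi * s\<^sup>2)" for s
    unfolding w_def norm_mult cmod_gauss_kernel by (intro mult_right_mono C) simp
  have gint: "integrable lborel (\<lambda>s. indicator A s * exp (2 * pi * Re a * s - pi * s\<^sup>2))" if "A \<in> sets borel" for A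
    using integrable_mult_indicator[of A lborel, OF _ gaussian_integral(1)[of pi "Re a"]] that by simp
  have tail: "cmod (LINT s|lborel. indicator A s *\<^sub>R w s) \<le> C * (LINT s|lborel. indicator A s * exp (2 * pi * Re a * s - pi * s\<^sup>2))"
    if A: "A \<in> sets borel" for A
  proof -
    have "cmod (LINT s|lborel. indicator A s *\<^sub>R w s) \<le> (LINT s|lborel. cmod (indicator A s *\<^sub>R w s))"
      by (rule integral_norm_bound)
    also have "\<dots> \<le> (LINT s|lborel. C * (indicator A s * exp (2 * pi * Re a * s - pi * s\<^sup>2)))"
      using nw by (intro integral_mono integrable_norm wi integrable_mult_right gint A) (auto simp: indicator_def)
    finally show ?thesis by simp
  qed
  have u_bound: "cmod (u t) * (1 + \<bar>t - Re a\<bar>) \<le> 2 * C * cmod (gauss_kernel a t)" for t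
  proof (cases "Re a \<le> t")
    case True
    have "(1 + \<bar>t - Re a\<bar>) * cmod (u t) \<le> (1 + \<bar>t - Re a\<bar>) * (C * (LINT s|lborel. indicator {t<..} s * exp (2 * pi * Re a * s - pi * s\<^sup>2)))"
      using tail[of "{t<..}"] unfolding u_right by (intro mult_left_mono) auto
    also have "\<dots> \<le> C * (2 * cmod (gauss_kernel a t))"
      using mult_left_mono[OF gaussian_tail_right[OF True] \<open>0 \<le> C\<close>] by (simp add: cmod_gauss_kernel ac_simps)
    finally show ?thesis by (simp add: ac_simps)
  next
    case False
    have "(1 + \<bar>t - Re a\<bar>) * cmod (u t) \<le> (1 + \<bar>t - Re a\<bar>) * (C * (LINT s|lborel. indicator {..<t} s * exp (2 * pi * Re a * s - pi * s\<^sup>2)))"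
      using tail[of "{..<t}"] unfolding u_def by (intro mult_left_mono) auto
    also have "\<dots> \<le> C * (2 * cmod (gauss_kernel a t))"
      using mult_left_mono[OF gaussian_tail_left[of t "Re a"] \<open>0 \<le> C\<close>] False by (simp add: cmod_gauss_kernel ac_simps)
    finally show ?thesis by (simp add: ac_simps)
  qed
  have gk0: "gauss_kernel z t \<noteq> 0" for z t by (simp add: gauss_kernel_def)
  define f where "f t = - (2 * of_real pi) * u t / gauss_kernel a t" for t
  have fcont: "continuous_on UNIV f" unfolding f_def
    by (intro continuous_intros ucont gk) (simp add: gk0)
  have fK: "cmod (f t) * (1 + \<bar>t - Re a\<bar>) \<le> 4 * pi * C" for t
  proof -
    have "cmod (f t) * (1 + \<bar>t - Re a\<bar>) = 2 * pi * (cmod (u t) * (1 + \<bar>t - Re a\<bar>)) / cmod (gauss_kernel a t)"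
      by (simp add: f_def norm_mult norm_divide)
    also have "\<dots> \<le> 2 * pi * (2 * C * cmod (gauss_kernel a t)) / cmod (gauss_kernel a t)"
      using u_bound[of t] by (intro divide_right_mono mult_left_mono) auto
    also have "\<dots> = 4 * pi * C" using gk0 by simp
    finally show ?thesis .
  qed
  have fb: "cmod (f t) \<le> 4 * pi * C" for t
  proof -
    have "cmod (f t) * 1 \<le> cmod (f t) * (1 + \<bar>t - Re a\<bar>)" by (intro mult_left_mono) auto
    then show ?thesis using fK[of t] by simp
  qed
  have ftame: "gauss_tame f"
    using fcont fb by (intro gauss_tame_bounded borel_measurable_continuous_onI)
  have "(z - a) * bargmann f z = bargmann c z" for z
  proof -
    \<comment> \<open>Up to the factor \<open>- 2 \<pi>\<close>, this is \<open>f\<close> times the kernel at \<open>z\<close>; its derivative \<open>V'\<close> integrates to \<open>0\<close>.\<close>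
    define V where "V t = u t * exp (2 * of_real pi * of_real t * (z - a))" for t
    define V' where "V' t = c t * gauss_kernel z t + (- (z - a)) * (f t * gauss_kernel z t)" for t
    have k: "gauss_kernel z t = gauss_kernel a t * exp (2 * of_real pi * of_real t * (z - a))" for t
      unfolding gauss_kernel_def exp_add[symmetric] by (simp add: algebra_simps)
    have fk: "f t * gauss_kernel z t = - (2 * of_real pi) * V t" for t
      unfolding k by (simp add: f_def V_def gk0)
    have V'int: "integrable lborel V'" unfolding V'_def
      by (intro Bochner_Integration.integrable_add integrable_mult_right bargmann_integrable tame ftame)
    have V_deriv: "(V has_vector_derivative V' t) (at t)" for t
    proof -
      have "((\<lambda>t. exp (2 * of_real pi * of_real t * (z - a))) has_vector_derivative
          exp (2 * of_real pi * of_real t * (z - a)) * (2 * of_real pi * (z - a))) (at t)"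
        by (rule has_vector_derivative_real_field) (auto intro!: derivative_eq_intros)
      from has_vector_derivative_mult[OF u_deriv this]
      have "(V has_vector_derivative u t * (exp (2 * of_real pi * of_real t * (z - a)) * (2 * of_real pi * (z - a)))
          + w t * exp (2 * of_real pi * of_real t * (z - a))) (at t)"
        by (simp add: V_def[abs_def])
      moreover have "u t * (exp (2 * of_real pi * of_real t * (z - a)) * (2 * of_real pi * (z - a)))
          + w t * exp (2 * of_real pi * of_real t * (z - a)) = V' t"
        unfolding V'_def fk by (simp add: V_def w_def k algebra_simps)
      ultimately show ?thesis by simp
    qed
    have V'cont: "isCont V' t" for t
    proof -
      have "continuous_on UNIV V'" unfolding V'_def by (intro continuous_intros cont gk fcont)
      then show ?thesis by (simp add: continuous_on_eq_continuous_at)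
    qed
    have Vle: "cmod (V t) \<le> 2 * C * exp (2 * pi * Re z * t - pi * t\<^sup>2)" for t
    proof -
      have "2 * pi * cmod (V t) = cmod (f t * gauss_kernel z t)" unfolding fk by (simp add: norm_mult)
      also have "\<dots> \<le> 4 * pi * C * exp (2 * pi * Re z * t - pi * t\<^sup>2)"
        unfolding norm_mult cmod_gauss_kernel by (intro mult_right_mono fb) simp
      finally show ?thesis by simp
    qed
    have lim: "(V \<longlongrightarrow> 0) F" if "((\<lambda>t. 2 * C * exp (2 * pi * Re z * t - pi * t\<^sup>2)) \<longlongrightarrow> 0) F" for F
      by (rule Lim_null_comparison[OF _ that]) (simp add: Vle)
    have V_top: "(V \<longlongrightarrow> 0) at_top" and V_bot: "(V \<longlongrightarrow> 0) at_bot"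
      by (rule lim, real_asymp)+
    have "(LBINT t=-\<infinity>..\<infinity>. V' t) = 0 - 0"
      by (rule interval_integral_FTC_integrable[where F = V])
         (use V_deriv V'cont V'int V_top V_bot in \<open>auto simp: set_integrable_def ereal_tendsto_simps\<close>)
    then have "integral\<^sup>L lborel V' = 0"
      by (simp add: interval_lebesgue_integral_def set_lebesgue_integral_def)
    moreover have "integral\<^sup>L lborel V' = bargmann c z + (- (z - a)) * bargmann f z"
      unfolding V'_def bargmann_def
      by (intro has_bochner_integral_integral_eq has_bochner_integral_add has_bochner_integral_mult_right
          has_bochner_integral_integrable bargmann_integrable tame ftame)
    ultimately show ?thesis by (simp add: algebra_simps)
  qed
  with fcont fK that show ?thesis by blast
qed

section \<open>Chirps and the biorthogonal system\<close>

definition chirp :: "complex \<Rightarrow> real \<Rightarrow> complex" where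
  "chirp \<theta> t = exp (\<theta> * of_real (pi * t\<^sup>2))"

lemma continuous_chirp: "continuous_on UNIV (chirp \<theta>)"
  unfolding chirp_def by (intro continuous_intros)

lemma cmod_chirp: "Re \<theta> = 0 \<Longrightarrow> cmod (chirp \<theta> t) = 1"
  by (simp add: chirp_def)

lemma gauss_tame_chirp: "Re \<theta> = 0 \<Longrightarrow> gauss_tame (chirp \<theta>)"
  by (rule gauss_tame_bounded[where C = 1])
     (auto simp: cmod_chirp intro!: borel_measurable_continuous_onI continuous_chirp)

text \<open>
  Completing the square by the real translation \<open>t \<mapsto> t + s\<close> evaluates the Gaussian integral on a line
  of complex arguments without shifting contours.
\<close>

lemma bargmann_chirp_line:
  "bargmann (chirp \<theta>) ((1 - \<theta>) * of_real s) = exp ((1 - \<theta>) * of_real (pi * s\<^sup>2)) * bargmann (chirp \<theta>) 0"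
proof -
  have "bargmann (chirp \<theta>) ((1 - \<theta>) * of_real s)
      = (LINT t|lborel. chirp \<theta> (s + 1 * t) * gauss_kernel ((1 - \<theta>) * of_real s) (s + 1 * t))"
    unfolding bargmann_def by (subst lborel_integral_real_affine[where c = 1 and t = s]) auto
  also have "\<dots> = (LINT t|lborel. exp ((1 - \<theta>) * of_real (pi * s\<^sup>2)) * (chirp \<theta> t * gauss_kernel 0 t))"
    by (intro Bochner_Integration.integral_cong)
       (simp_all add: chirp_def gauss_kernel_def mult_exp_exp power2_eq_square algebra_simps)
  finally show ?thesis by (simp add: bargmann_def)
qed

text \<open>
  Both sides are entire and agree on a line. The constant is nonzero since otherwise the transform
  would vanish identically.
\<close>

lemma bargmann_chirp:
  assumes \<theta>: "Re \<theta> = 0"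
  shows "bargmann (chirp \<theta>) z = exp (of_real pi * z\<^sup>2 / (1 - \<theta>)) * bargmann (chirp \<theta>) 0"
    and "bargmann (chirp \<theta>) 0 \<noteq> 0"
proof -
  have nz: "1 - \<theta> \<noteq> 0" using \<theta> by auto
  have eq: "bargmann (chirp \<theta>) z = exp (of_real pi * z\<^sup>2 / (1 - \<theta>)) * bargmann (chirp \<theta>) 0" for z
  proof -
    define D where "D z = bargmann (chirp \<theta>) z - exp (of_real pi * z\<^sup>2 / (1 - \<theta>)) * bargmann (chirp \<theta>) 0" for z
    have "D z = 0"
    proof (rule analytic_continuation[where S = UNIV and \<xi> = 0 and f = D and w = z])
      show "D holomorphic_on UNIV" unfolding D_def
        using nz by (intro holomorphic_intros bargmann_entire gauss_tame_chirp \<theta>)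
      show "0 islimpt range (\<lambda>s. (1 - \<theta>) * of_real s)"
        unfolding islimpt_sequential
      proof (intro exI conjI allI)
        show "(1 - \<theta>) * of_real (inverse (real (Suc n))) \<in> range (\<lambda>s. (1 - \<theta>) * of_real s) - {0}" for n
          unfolding Diff_iff using nz by (intro conjI rangeI) (simp del: of_nat_Suc)
        have "(\<lambda>n. (1 - \<theta>) * of_real (inverse (real (Suc n)))) \<longlonglongrightarrow> (1 - \<theta>) * of_real 0"
          by (intro tendsto_intros LIMSEQ_inverse_real_of_nat)
        then show "(\<lambda>n. (1 - \<theta>) * of_real (inverse (real (Suc n)))) \<longlonglongrightarrow> 0" by simp
      qed
      show "D y = 0" if "y \<in> range (\<lambda>s. (1 - \<theta>) * of_real s)" for y
      proof -
        from that obtain s where y: "y = (1 - \<theta>) * of_real s" by auto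
        have "of_real pi * y\<^sup>2 / (1 - \<theta>) = (1 - \<theta>) * of_real (pi * s\<^sup>2)"
          using nz by (simp add: y power2_eq_square)
        then show ?thesis unfolding D_def y bargmann_chirp_line by simp
      qed
    qed auto
    then show ?thesis by (simp add: D_def)
  qed
  then show "bargmann (chirp \<theta>) z = exp (of_real pi * z\<^sup>2 / (1 - \<theta>)) * bargmann (chirp \<theta>) 0" .
  show "bargmann (chirp \<theta>) 0 \<noteq> 0"
  proof
    assume 0: "bargmann (chirp \<theta>) 0 = 0"
    have "bargmann (chirp \<theta>) z = 0" for z
      unfolding eq[of z] 0 by simp
    then have "AE t in lborel. chirp \<theta> t = 0"
      by (rule bargmann_injective[OF gauss_tame_chirp[OF \<theta>]])
    then have "AE t::real in lborel. False" by eventually_elim (simp add: chirp_def)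
    then have "emeasure lborel (UNIV :: real set) = 0" by (simp add: AE_iff_measurable[OF _ refl])
    then show False by simp
  qed
qed

definition sine_function :: "complex \<Rightarrow> complex" where
  "sine_function z = exp (of_real pi * z\<^sup>2 / 2) * sin (of_real pi * z\<^sup>2 / 2)"

lemma sine_function_eq_0_iff: "sine_function z = 0 \<longleftrightarrow> sin (of_real pi * z\<^sup>2 / 2) = 0"
  by (simp add: sine_function_def)

lemma sine_function_deriv:
  assumes "sine_function z = 0"
  shows "(sine_function has_field_derivative
    exp (of_real pi * z\<^sup>2 / 2) * (cos (of_real pi * z\<^sup>2 / 2) * (of_real pi * z))) (at z)"
  using assms unfolding sine_function_eq_0_iff unfolding sine_function_def[abs_def]
  by (auto intro!: derivative_eq_intros)

text \<open>
  Because \<open>1 / (1 \<mp> \<i>) = (1 \<plusminus> \<i>) / 2\<close>, the transforms of the two chirps are multiples of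
  \<open>exp (\<pi> z\<^sup>2 / 2) exp (\<plusminus> \<i> \<pi> z\<^sup>2 / 2)\<close>.
\<close>

lemma exists_preimage_of_sine_function:
  obtains c \<gamma> C where "continuous_on UNIV c" "\<And>t. cmod (c t) \<le> C" "\<gamma> \<noteq> 0"
    "\<And>z. bargmann c z = \<gamma> * sine_function z"
proof -
  define p where "p = bargmann (chirp \<i>) 0"
  define q where "q = bargmann (chirp (- \<i>)) 0"
  have nz: "p \<noteq> 0" "q \<noteq> 0" unfolding p_def q_def by (rule bargmann_chirp, simp)+
  define c where "c = chirp \<i> + cscale (- (p / q)) (chirp (- \<i>))"
  show ?thesis
  proof
    have c: "c = (\<lambda>t. chirp \<i> t - p / q * chirp (- \<i>) t)"
      by (simp add: c_def cscale_def fun_eq_iff)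
    show "continuous_on UNIV c" unfolding c by (intro continuous_intros continuous_chirp)
    show "cmod (c t) \<le> 1 + cmod (p / q)" for t
      unfolding c by (rule order_trans[OF norm_triangle_ineq4]) (simp add: norm_mult norm_divide cmod_chirp)
    show "2 * \<i> * p \<noteq> 0" using nz by simp
    fix z :: complex
    have i1: "w / (1 - \<i>) = w / 2 + \<i> * (w / 2)" and i2: "w / (1 - - \<i>) = w / 2 - \<i> * (w / 2)" for w
    proof -
      have "1 - \<i> \<noteq> 0" "1 - - \<i> \<noteq> 0" by (simp_all add: complex_eq_iff)
      then show "w / (1 - \<i>) = w / 2 + \<i> * (w / 2)" "w / (1 - - \<i>) = w / 2 - \<i> * (w / 2)"
        unfolding nonzero_divide_eq_eq[OF \<open>1 - \<i> \<noteq> 0\<close>] nonzero_divide_eq_eq[OF \<open>1 - - \<i> \<noteq> 0\<close>]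
        by (simp_all add: field_simps)
    qed
    have "bargmann c z = bargmann (chirp \<i>) z - p / q * bargmann (chirp (- \<i>)) z"
      unfolding c_def by (subst bargmann_add_scaled) (auto intro: gauss_tame_chirp)
    also have "\<dots> = p * (exp (of_real pi * z\<^sup>2 / (1 - \<i>)) - exp (of_real pi * z\<^sup>2 / (1 - - \<i>)))"
      using nz by (subst (1 2) bargmann_chirp(1)) (auto simp: p_def[symmetric] q_def[symmetric] algebra_simps)
    also have "\<dots> = 2 * \<i> * p * sine_function z"
      unfolding i1 i2 sine_function_def sin_exp_eq exp_add exp_diff exp_minus by (simp add: field_simps)
    finally show "bargmann c z = 2 * \<i> * p * sine_function z" .
  qed
qed

text \<open>
  This reads off the value of a quotient at the point where it was divided, which is needed to see
  whether a further division is possible and that the final value is nonzero.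
\<close>

lemma quotient_value:
  assumes B: "B holomorphic_on UNIV" and eq: "\<And>z. (z - a) * B z = \<Phi> z"
    and \<Phi>: "(\<Phi> has_field_derivative D) (at a)"
  shows "B a = D"
proof -
  have "(B has_field_derivative deriv B a) (at a)" using holomorphic_derivI[OF B] by simp
  then have "((\<lambda>z. (z - a) * B z) has_field_derivative B a) (at a)"
    by (auto intro!: derivative_eq_intros)
  then show ?thesis using \<Phi> unfolding eq by (rule DERIV_unique)
qed

definition bounded_continuous :: "(real \<Rightarrow> complex) \<Rightarrow> bool" where
  "bounded_continuous f \<longleftrightarrow> continuous_on UNIV f \<and> (\<exists>C. \<forall>t. cmod (f t) \<le> C)"

lemma gauss_tame_bounded_continuous: "bounded_continuous f \<Longrightarrow> gauss_tame f"
  by (auto simp: bounded_continuous_def intro: gauss_tame_bounded borel_measurable_continuous_onI)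

lemma bargmann_divide_L2:
  assumes "bounded_continuous c" "bargmann c a = 0"
  obtains f where "bounded_continuous f" "f \<in> L2" "\<And>z. (z - a) * bargmann f z = bargmann c z"
proof -
  from assms obtain f K where f: "continuous_on UNIV f" and K: "\<And>t. cmod (f t) * (1 + \<bar>t - Re a\<bar>) \<le> K"
    and eq: "\<And>z. (z - a) * bargmann f z = bargmann c z"
    unfolding bounded_continuous_def by (metis bargmann_divide)
  have "cmod (f t) \<le> K" for t
  proof -
    have "cmod (f t) * 1 \<le> cmod (f t) * (1 + \<bar>t - Re a\<bar>)" by (intro mult_left_mono) auto
    then show ?thesis using K[of t] by simp
  qed
  then have "bounded_continuous f" using f by (auto simp: bounded_continuous_def)
  moreover have "f \<in> L2"
    using f K by (intro decaying_in_L2 borel_measurable_continuous_onI)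
  ultimately show ?thesis using eq that by blast
qed

text \<open>
  For \<open>\<kappa> = \<plusminus> 1\<close> the wanted transform is a multiple of \<open>(z + \<kappa>) S(z) / z\<^sup>2 = S(z) / z + \<kappa> S(z) / z\<^sup>2\<close> with
  \<open>S = sine_function\<close>; for the other points it is a multiple of
  \<open>(z\<^sup>2 - 1) S(z) / (z\<^sup>2 (z - \<kappa>)) = S(z) / (z - \<kappa>) - S(z) / (z\<^sup>2 (z - \<kappa>))\<close>. Every summand is reached
  by successive divisions of \<open>S\<close>, using that \<open>S\<close> has a double zero at \<open>0\<close>.
\<close>

lemma exists_biorthogonal:
  assumes \<kappa>: "\<kappa> \<in> sampling_set"
  obtains f where "f \<in> L2" "bargmann f \<kappa> \<noteq> 0" "\<And>\<mu>. \<mu> \<in> sampling_set \<Longrightarrow> \<mu> \<noteq> \<kappa> \<Longrightarrow> bargmann f \<mu> = 0"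
proof -
  obtain c \<gamma> where c: "bounded_continuous c" and \<gamma>: "\<gamma> \<noteq> 0" and bc: "\<And>z. bargmann c z = \<gamma> * sine_function z"
    unfolding bounded_continuous_def by (rule exists_preimage_of_sine_function) blast
  have \<Phi>: "((\<lambda>z. \<gamma> * sine_function z) has_field_derivative
      \<gamma> * (exp (of_real pi * z\<^sup>2 / 2) * (cos (of_real pi * z\<^sup>2 / 2) * (of_real pi * z)))) (at z)"
    if "sine_function z = 0" for z
    by (intro DERIV_cmult sine_function_deriv that)
  have s0: "sine_function 0 = 0" by (simp add: sine_function_def)
  have set: "\<mu>\<^sup>2 = 1 \<or> \<mu> \<noteq> 0 \<and> sine_function \<mu> = 0" if "\<mu> \<in> sampling_set" for \<mu>
    using that by (simp add: sampling_set_def sine_function_eq_0_iff)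
  have ent: "bargmann f holomorphic_on UNIV" if "bounded_continuous f" for f
    using that by (intro bargmann_entire gauss_tame_bounded_continuous)
  show ?thesis
  proof (cases "\<kappa>\<^sup>2 = 1")
    case True
    then have "\<kappa> \<noteq> 0" by auto
    have "bargmann c 0 = 0" by (simp add: bc s0)
    then obtain fb where fb: "bounded_continuous fb" "fb \<in> L2" "\<And>z. (z - 0) * bargmann fb z = bargmann c z"
      using bargmann_divide_L2[OF c] by metis
    have "bargmann fb 0 = 0"
      using quotient_value[OF ent[OF fb(1)] fb(3)[unfolded bc] \<Phi>[OF s0]] by simp
    then obtain fc where fc: "bounded_continuous fc" "fc \<in> L2" "\<And>z. (z - 0) * bargmann fc z = bargmann fb z"
      using bargmann_divide_L2[OF fb(1)] by metis
    have bf: "bargmann (fb + cscale \<kappa> fc) z = (z + \<kappa>) * bargmann fc z" for z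
      using fc(3)[of z] fb(1) fc(1)
      by (subst bargmann_add_scaled) (auto intro: gauss_tame_bounded_continuous simp: algebra_simps)
    have fc2: "z\<^sup>2 * bargmann fc z = \<gamma> * sine_function z" for z
      using fc(3)[of z] fb(3)[of z] bc[of z] by (simp add: power2_eq_square mult.assoc)
    show ?thesis
    proof (rule that)
      show "fb + cscale \<kappa> fc \<in> L2" using fb(2) fc(2) by (rule L2_add_scaled)
      have "sin (of_real pi / 2 :: complex) = 1"
        by (metis of_real_1 of_real_divide of_real_numeral sin_of_real sin_pi_half)
      then have "sine_function \<kappa> \<noteq> 0" using True by (simp add: sine_function_eq_0_iff)
      then show "bargmann (fb + cscale \<kappa> fc) \<kappa> \<noteq> 0"
        using fc2[of \<kappa>] \<gamma> \<open>\<kappa> \<noteq> 0\<close> unfolding bf by auto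
      fix \<mu> assume \<mu>: "\<mu> \<in> sampling_set" "\<mu> \<noteq> \<kappa>"
      from set[OF \<mu>(1)] show "bargmann (fb + cscale \<kappa> fc) \<mu> = 0"
      proof
        assume "\<mu>\<^sup>2 = 1"
        then have "\<mu> = - \<kappa>" using True \<mu>(2) by (metis power2_eq_iff)
        then show ?thesis by (simp add: bf)
      next
        assume "\<mu> \<noteq> 0 \<and> sine_function \<mu> = 0"
        then show ?thesis using fc2[of \<mu>] by (simp add: bf)
      qed
    qed
  next
    case False
    then have \<kappa>0: "\<kappa> \<noteq> 0" "sine_function \<kappa> = 0" using set[OF \<kappa>] by auto
    have "bargmann c \<kappa> = 0" by (simp add: bc \<kappa>0)
    then obtain fa where fa: "bounded_continuous fa" "fa \<in> L2" "\<And>z. (z - \<kappa>) * bargmann fa z = bargmann c z"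
      using bargmann_divide_L2[OF c] by metis
    have "cos (of_real pi * \<kappa>\<^sup>2 / 2) \<noteq> 0"
      using \<kappa>0(2) unfolding sine_function_eq_0_iff by (metis sin_cos_squared_add add_0_left power_zero_numeral zero_neq_one)
    then have fa\<kappa>: "bargmann fa \<kappa> \<noteq> 0"
      using quotient_value[OF ent[OF fa(1)] fa(3)[unfolded bc] \<Phi>[OF \<kappa>0(2)]] \<gamma> \<kappa>0(1) by simp
    have "bargmann fa 0 = 0" using fa(3)[of 0] \<kappa>0(1) by (simp add: bc s0)
    then obtain fb where fb: "bounded_continuous fb" "fb \<in> L2" "\<And>z. (z - 0) * bargmann fb z = bargmann fa z"
      using bargmann_divide_L2[OF fa(1)] by metis
    \<comment> \<open>The product \<open>(z - \<kappa>) bargmann fb z\<close> is \<open>S(z) / z\<close> up to a constant, so at \<open>0\<close> it is the derivative of \<open>S\<close> there.\<close>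
    have "(0 - \<kappa>) * bargmann fb 0 = \<gamma> * (exp (of_real pi * 0\<^sup>2 / 2) * (cos (of_real pi * 0\<^sup>2 / 2) * (of_real pi * 0)))"
    proof (rule quotient_value[where B = "\<lambda>z. (z - \<kappa>) * bargmann fb z", OF _ _ \<Phi>[OF s0]])
      show "(\<lambda>z. (z - \<kappa>) * bargmann fb z) holomorphic_on UNIV" by (intro holomorphic_intros ent fb(1))
      show "(z - 0) * ((z - \<kappa>) * bargmann fb z) = \<gamma> * sine_function z" for z
        unfolding mult.left_commute[of "z - 0"] fb(3) fa(3) bc ..
    qed
    then have "bargmann fb 0 = 0" using \<kappa>0(1) by simp
    then obtain fc where fc: "bounded_continuous fc" "fc \<in> L2" "\<And>z. (z - 0) * bargmann fc z = bargmann fb z"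
      using bargmann_divide_L2[OF fb(1)] by metis
    have fc2: "bargmann fa z = z\<^sup>2 * bargmann fc z" for z
      using fc(3)[of z] fb(3)[of z] by (simp add: power2_eq_square mult.assoc)
    have bf: "bargmann (fa + cscale (- 1) fc) z = (z\<^sup>2 - 1) * bargmann fc z" for z
      using fc2[of z] fa(1) fc(1)
      by (subst bargmann_add_scaled) (auto intro: gauss_tame_bounded_continuous simp: algebra_simps)
    show ?thesis
    proof (rule that)
      show "fa + cscale (- 1) fc \<in> L2" using fa(2) fc(2) by (rule L2_add_scaled)
      show "bargmann (fa + cscale (- 1) fc) \<kappa> \<noteq> 0"
        using fa\<kappa> fc2[of \<kappa>] False unfolding bf by auto
      fix \<mu> assume \<mu>: "\<mu> \<in> sampling_set" "\<mu> \<noteq> \<kappa>"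
      from set[OF \<mu>(1)] show "bargmann (fa + cscale (- 1) fc) \<mu> = 0"
      proof
        assume "\<mu>\<^sup>2 = 1"
        then show ?thesis unfolding bf by simp
      next
        assume "\<mu> \<noteq> 0 \<and> sine_function \<mu> = 0"
        then show ?thesis using fc2[of \<mu>] fa(3)[of \<mu>] \<mu>(2) unfolding bf bc by auto
      qed
    qed
  qed
qed

section \<open>The Gabor system\<close>

lemma cnj_tf_shift_gaussian:
  "cnj (tf_shift x y (\<lambda>t. of_real (exp (- pi * t\<^sup>2))) t)
    = of_real (exp (- pi * x\<^sup>2)) * gauss_kernel (Complex x (- y)) t"
proof -
  have "cnj (tf_shift x y (\<lambda>t. of_real (exp (- pi * t\<^sup>2))) t)
      = exp (- (2 * of_real pi * \<i> * of_real y * of_real t) + of_real (- pi * (t - x)\<^sup>2))"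
    unfolding exp_add exp_of_real by (simp add: tf_shift_def exp_cnj)
  also have "- (2 * of_real pi * \<i> * of_real y * of_real t) + of_real (- pi * (t - x)\<^sup>2)
      = of_real (- pi * x\<^sup>2) + (2 * of_real pi * of_real t * Complex x (- y) - of_real (pi * t\<^sup>2))"
    by (simp add: complex_eq_iff power2_eq_square algebra_simps)
  finally show ?thesis unfolding exp_add exp_of_real gauss_kernel_def .
qed

lemma tf_shift_gaussian_L2: "tf_shift x y (\<lambda>t. of_real (exp (- pi * t\<^sup>2))) \<in> L2"
proof -
  let ?\<rho> = "tf_shift x y (\<lambda>t. of_real (exp (- pi * t\<^sup>2)))"
  have m: "?\<rho> \<in> borel_measurable borel" unfolding tf_shift_def by measurable
  have "cmod (?\<rho> t) = exp (- pi * x\<^sup>2) * exp (2 * pi * x * t - pi * t\<^sup>2)" for t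
  proof -
    have "cmod (?\<rho> t) = cmod (cnj (?\<rho> t))" by simp
    then show ?thesis unfolding cnj_tf_shift_gaussian by (simp add: norm_mult cmod_gauss_kernel)
  qed
  then have eq: "(cmod (?\<rho> t))\<^sup>2 = (exp (- pi * x\<^sup>2))\<^sup>2 * exp (2 * (2 * pi) * x * t - (2 * pi) * t\<^sup>2)" for t
    by (simp add: power_mult_distrib exp_double[symmetric] algebra_simps)
  show ?thesis unfolding L2_def mem_Collect_eq eq
  proof
    show "?\<rho> \<in> borel_measurable lborel" using m by simp
  qed (intro integrable_mult_right gaussian_integral, simp)
qed

lemma L2_inner_tf_shift_gaussian:
  "L2_inner f (tf_shift x y (\<lambda>t. of_real (exp (- pi * t\<^sup>2))))
    = of_real (exp (- pi * x\<^sup>2)) * bargmann f (Complex x (- y))"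
proof -
  have "f t * cnj (tf_shift x y (\<lambda>t. of_real (exp (- pi * t\<^sup>2))) t)
      = of_real (exp (- pi * x\<^sup>2)) * (f t * gauss_kernel (Complex x (- y)) t)" for t
    unfolding cnj_tf_shift_gaussian by (rule mult.left_commute)
  then show ?thesis unfolding L2_inner_def bargmann_def by (simp only: integral_mult_right_zero)
qed

lemma sampling_set_iff:
  fixes \<Lambda> :: "(real \<times> real) set"
  assumes "\<Lambda> = {(-1, 0), (1, 0)}
      \<union> {(0, s * sqrt (2 * real n)) | s n. s \<in> {1, -1} \<and> n \<ge> 1}
      \<union> {(s * sqrt (2 * real n), 0) | s n. s \<in> {1, -1} \<and> n \<ge> 1}"
  shows "Complex x (- y) \<in> sampling_set \<longleftrightarrow> (x, y) \<in> \<Lambda>"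
proof
  have sin0: "sin (of_real pi * w / 2) = 0 \<longleftrightarrow> (\<exists>k::int. w = of_int (2 * k))" for w :: complex
  proof -
    have "sin (of_real pi * w / 2) = 0 \<longleftrightarrow> (\<exists>k::int. of_real pi * w / 2 = of_real (of_int k * pi))"
      by (simp add: sin_eq_0)
    also have "\<dots> \<longleftrightarrow> (\<exists>k::int. w = of_int (2 * k))"
      by (intro ex_cong1) (auto simp: field_simps)
    finally show ?thesis .
  qed
  assume z: "Complex x (- y) \<in> sampling_set"
  have re: "Re ((Complex x (- y))\<^sup>2) = x\<^sup>2 - y\<^sup>2" and im: "Im ((Complex x (- y))\<^sup>2) = - (2 * x * y)"
    by (simp_all add: power2_eq_square)
  consider "(Complex x (- y))\<^sup>2 = 1" | k :: int where "(Complex x (- y))\<^sup>2 = of_int (2 * k)" "k \<noteq> 0"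
    using z unfolding sampling_set_def mem_Collect_eq sin0 by fastforce
  then show "(x, y) \<in> \<Lambda>"
  proof cases
    case 1
    then have "Complex x (- y) = 1 \<or> Complex x (- y) = - 1" by (simp add: power2_eq_1_iff)
    then show ?thesis by (auto simp: assms complex_eq_iff)
  next
    case 2
    then have r: "x\<^sup>2 - y\<^sup>2 = 2 * of_int k" and "x * y = 0"
      using re im by auto
    from this(2) consider "x = 0" | "y = 0" by auto
    then show ?thesis
    proof cases
      assume "x = 0"
      then have y2: "y\<^sup>2 = - 2 * of_int k" using r by simp
      then have "k < 0" using 2(2) zero_le_power2[of y] by (cases k "0::int" rule: linorder_cases) auto
      define n where "n = nat (- k)"
      have n: "1 \<le> n" "real n = - of_int k" using \<open>k < 0\<close> by (auto simp: n_def)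
      then have "\<bar>y\<bar> = sqrt (2 * real n)" using y2 by (simp flip: real_sqrt_abs)
      then have "y = 1 * sqrt (2 * real n) \<or> y = - 1 * sqrt (2 * real n)" by linarith
      then show ?thesis using n(1) \<open>x = 0\<close> unfolding assms by blast
    next
      assume "y = 0"
      then have x2: "x\<^sup>2 = 2 * of_int k" using r by simp
      then have "0 < k" using 2(2) zero_le_power2[of x] by (cases k "0::int" rule: linorder_cases) auto
      define n where "n = nat k"
      have n: "1 \<le> n" "real n = of_int k" using \<open>0 < k\<close> by (auto simp: n_def)
      then have "\<bar>x\<bar> = sqrt (2 * real n)" using x2 by (simp flip: real_sqrt_abs)
      then have "x = 1 * sqrt (2 * real n) \<or> x = - 1 * sqrt (2 * real n)" by linarith
      then show ?thesis using n(1) \<open>y = 0\<close> unfolding assms by blast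
    qed
  qed
next
  have sin_nat: "sin (of_real pi * of_real r / 2 :: complex) = 0" if "r = 2 * real n \<or> r = - 2 * real n" for r n
  proof -
    have "of_real pi * of_real r / 2 = (of_real (pi * r / 2) :: complex)" by simp
    moreover have "sin (pi * r / 2) = 0" using that by (auto simp: mult.commute)
    ultimately show ?thesis by (metis sin_of_real of_real_0)
  qed
  assume "(x, y) \<in> \<Lambda>"
  then consider "y = 0" "x = 1 \<or> x = - 1"
    | s n where "x = 0" "y = s * sqrt (2 * real n)" "s \<in> {1, -1}" "1 \<le> n"
    | s n where "y = 0" "x = s * sqrt (2 * real n)" "s \<in> {1, -1}" "1 \<le> n"
    unfolding assms by blast
  then show "Complex x (- y) \<in> sampling_set"
  proof cases
    case 1
    then have "(Complex x (- y))\<^sup>2 = 1" by (auto simp: complex_eq_iff power2_eq_square)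
    then show ?thesis by (simp add: sampling_set_def)
  next
    case 2
    have "y\<^sup>2 = 2 * real n" using 2(2,3) by (auto simp: power_mult_distrib)
    then have "(Complex x (- y))\<^sup>2 = of_real (- 2 * real n)"
      using 2(1) by (simp add: complex_eq_iff power2_eq_square)
    moreover have "Complex x (- y) \<noteq> 0" using 2 by (auto simp: complex_eq_iff)
    ultimately show ?thesis using sin_nat[of "- 2 * real n" n] by (simp add: sampling_set_def)
  next
    case 3
    have "x\<^sup>2 = 2 * real n" using 3(2,3) by (auto simp: power_mult_distrib)
    then have "(Complex x (- y))\<^sup>2 = of_real (2 * real n)"
      using 3(1) by (simp add: complex_eq_iff power2_eq_square)
    moreover have "Complex x (- y) \<noteq> 0" using 3 by (auto simp: complex_eq_iff)
    ultimately show ?thesis using sin_nat[of "2 * real n" n] by (simp add: sampling_set_def)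
  qed
qed

text \<open>
  Multiplication by \<open>exp (- \<pi> z\<^sup>2 / 2)\<close> turns the growth \<open>exp (\<pi> (Re z)\<^sup>2)\<close> of the transform into the symmetric
  growth \<open>exp (\<pi> \<bar>z\<bar>\<^sup>2 / 2)\<close> and does not change the modulus on the diagonal.
\<close>

lemma bargmann_uniqueness:
  assumes f: "f \<in> L2" and zero: "\<And>\<mu>. \<mu> \<in> sampling_set \<Longrightarrow> bargmann f \<mu> = 0"
  shows "L2_norm f = 0"
proof -
  note tame = gauss_tame_L2[OF f]
  define F where "F z = exp (- (of_real pi * z\<^sup>2 / 2)) * bargmann f z" for z
  have cF: "cmod (F z) = exp (- (pi / 2 * Re (z\<^sup>2))) * cmod (bargmann f z)" for z
    by (simp add: F_def norm_mult)
  have "F z = 0" for z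
  proof (rule fock_uniqueness[where F = F])
    show "F holomorphic_on UNIV" unfolding F_def
      by (intro holomorphic_intros bargmann_entire[OF tame]) auto
    show "cmod (F z) \<le> L2_norm f * exp (pi / 2 * (cmod z)\<^sup>2)" for z
    proof -
      have "cmod (F z) \<le> exp (- (pi / 2 * Re (z\<^sup>2))) * (L2_norm f * exp (pi * (Re z)\<^sup>2))"
        unfolding cF by (intro mult_left_mono bargmann_growth f) simp
      also have "\<dots> = L2_norm f * exp (- (pi / 2 * Re (z\<^sup>2)) + pi * (Re z)\<^sup>2)"
        unfolding exp_add by (simp only: ac_simps)
      also have "- (pi / 2 * Re (z\<^sup>2)) + pi * (Re z)\<^sup>2 = pi / 2 * (cmod z)\<^sup>2"
        unfolding cmod_power2 by (simp add: power2_eq_square algebra_simps)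
      finally show ?thesis .
    qed
    show "F \<mu> = 0" if "\<mu> \<in> sampling_set" for \<mu> using zero[OF that] by (simp add: F_def)
    have "Re ((Complex x x)\<^sup>2) = 0" for x by (simp add: power2_eq_square)
    then show "((\<lambda>x. cmod (F (Complex x x)) * exp (- pi * x\<^sup>2)) \<longlongrightarrow> 0) at_top"
      unfolding cF using bargmann_decay[OF f, of "\<lambda>x. x"] by simp
  qed
  then have "bargmann f z = 0" for z by (simp add: F_def)
  then have "AE t in lborel. f t = 0" by (rule bargmann_injective[OF tame])
  then have "(LINT t|lborel. (cmod (f t))\<^sup>2) = 0"
    by (intro integral_eq_zero_AE) (auto elim: eventually_mono)
  then show ?thesis by (simp add: L2_norm_def)
qed

text \<open>
  The functional \<open>h \<mapsto> L2_inner \<phi> h\<close> is continuous by Cauchy-Schwarz and vanishes on the span of \<open>S\<close>.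
\<close>

lemma not_in_L2_closure_if_separated:
  assumes \<phi>: "\<phi> \<in> L2" and S: "S \<subseteq> L2" and orth: "\<And>v. v \<in> S \<Longrightarrow> L2_inner \<phi> v = 0"
    and f: "L2_inner \<phi> f \<noteq> 0"
  shows "f \<notin> L2_closure (cfun.span S)"
proof
  assume "f \<in> L2_closure (cfun.span S)"
  then have fL: "f \<in> L2" and approx: "\<And>\<epsilon>. 0 < \<epsilon> \<Longrightarrow> \<exists>h\<in>cfun.span S. L2_norm (f - h) < \<epsilon>"
    by (auto simp: L2_closure_def)
  have lin: "L2_inner \<phi> (h + cscale c k) = L2_inner \<phi> h + cnj c * L2_inner \<phi> k"
    if "h \<in> L2" "k \<in> L2" for h k c
  proof -
    have "(LINT t|lborel. \<phi> t * cnj (h t) + cnj c * (\<phi> t * cnj (k t))) = L2_inner \<phi> h + cnj c * L2_inner \<phi> k"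
      unfolding L2_inner_def
      by (intro has_bochner_integral_integral_eq has_bochner_integral_add has_bochner_integral_mult_right
          has_bochner_integral_integrable L2_integrable_inner \<phi> that)
    then show ?thesis by (simp add: L2_inner_def cscale_def algebra_simps)
  qed
  define W where "W = {h \<in> L2. L2_inner \<phi> h = 0}"
  have "cfun.subspace W"
  proof (rule cfun.subspaceI)
    show 0: "0 \<in> W" by (simp add: W_def L2_zero L2_inner_def)
    show "x + y \<in> W" if "x \<in> W" "y \<in> W" for x y
      using that lin[of x y 1] by (auto simp: W_def intro: L2_add)
    show "cscale c x \<in> W" if "x \<in> W" for c x
      using that 0 lin[of 0 x c] by (auto simp: W_def intro: L2_scale)
  qed
  moreover have "S \<subseteq> W" using S orth by (auto simp: W_def)
  ultimately have span: "cfun.span S \<subseteq> W" by (intro cfun.span_minimal)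
  define \<epsilon> where "\<epsilon> = cmod (L2_inner \<phi> f) / (L2_norm \<phi> + 1)"
  have pos: "0 < L2_norm \<phi> + 1" by (simp add: add_nonneg_pos)
  then have "0 < \<epsilon>" using f by (simp add: \<epsilon>_def)
  then obtain h where h: "h \<in> W" "L2_norm (f - h) < \<epsilon>" using approx span by blast
  then have hL: "h \<in> L2" and h0: "L2_inner \<phi> h = 0" by (auto simp: W_def)
  have "L2_inner \<phi> (f - h) = L2_inner \<phi> f"
    using lin[OF fL hL, of "- 1"] h0 by (simp add: cscale_m1)
  then have "cmod (L2_inner \<phi> f) \<le> L2_norm \<phi> * L2_norm (f - h)"
    using cmod_L2_inner_le[OF \<phi> L2_diff[OF fL hL]] by simp
  also have "\<dots> \<le> L2_norm \<phi> * \<epsilon>" using h(2) by (intro mult_left_mono) auto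
  also have "\<dots> < (L2_norm \<phi> + 1) * \<epsilon>" using \<open>0 < \<epsilon>\<close> by simp
  also have "\<dots> = cmod (L2_inner \<phi> f)" using pos by (simp add: \<epsilon>_def)
  finally show False by simp
qed

theorem theorem1:
  fixes g :: "real \<Rightarrow> complex" and \<Lambda> :: "(real \<times> real) set"
  assumes "g = (\<lambda>t. of_real (exp (- pi * t\<^sup>2)))"
    and "\<Lambda> = {(-1, 0), (1, 0)}
      \<union> {(0, s * sqrt (2 * real n)) | s n. s \<in> {1, -1} \<and> n \<ge> 1}
      \<union> {(s * sqrt (2 * real n), 0) | s n. s \<in> {1, -1} \<and> n \<ge> 1}"
  shows "complete_system (gabor_system g \<Lambda>) \<and> minimal_system (gabor_system g \<Lambda>)"
proof -
  note mem = sampling_set_iff[OF assms(2)]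
  have sub: "gabor_system g \<Lambda> \<subseteq> L2"
    using tf_shift_gaussian_L2 by (auto simp: gabor_system_def assms(1))
  have inner: "L2_inner f (tf_shift x y g) = of_real (exp (- pi * x\<^sup>2)) * bargmann f (Complex x (- y))" for f x y
    unfolding assms(1) by (rule L2_inner_tf_shift_gaussian)
  have "L2_closure (cfun.span (gabor_system g \<Lambda>)) = L2"
  proof (rule L2_closure_eq_if_orthogonal_trivial)
    show "cfun.subspace (cfun.span (gabor_system g \<Lambda>))" by (rule cfun.subspace_span)
    show "cfun.span (gabor_system g \<Lambda>) \<subseteq> L2" by (rule cfun.span_minimal[OF sub subspace_L2])
    fix e assume e: "e \<in> L2" and orth: "\<And>v. v \<in> cfun.span (gabor_system g \<Lambda>) \<Longrightarrow> L2_inner e v = 0"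
    show "L2_norm e = 0"
    proof (rule bargmann_uniqueness[OF e])
      fix \<mu> assume "\<mu> \<in> sampling_set"
      then have "(Re \<mu>, - Im \<mu>) \<in> \<Lambda>" using mem[of "Re \<mu>" "- Im \<mu>"] by simp
      then have "tf_shift (Re \<mu>) (- Im \<mu>) g \<in> gabor_system g \<Lambda>" by (auto simp: gabor_system_def)
      then have "L2_inner e (tf_shift (Re \<mu>) (- Im \<mu>) g) = 0" by (intro orth cfun.span_base)
      then show "bargmann e \<mu> = 0" unfolding inner by simp
    qed
  qed
  moreover have "f \<notin> L2_closure (cfun.span (gabor_system g \<Lambda> - {f}))" if "f \<in> gabor_system g \<Lambda>" for f
  proof -
    from that obtain x y where f: "f = tf_shift x y g" and xy: "(x, y) \<in> \<Lambda>"
      by (auto simp: gabor_system_def)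
    obtain \<phi> where \<phi>: "\<phi> \<in> L2" "bargmann \<phi> (Complex x (- y)) \<noteq> 0"
      "\<And>\<mu>. \<mu> \<in> sampling_set \<Longrightarrow> \<mu> \<noteq> Complex x (- y) \<Longrightarrow> bargmann \<phi> \<mu> = 0"
      using exists_biorthogonal[of "Complex x (- y)"] mem xy by metis
    show ?thesis
    proof (rule not_in_L2_closure_if_separated[OF \<phi>(1)])
      show "gabor_system g \<Lambda> - {f} \<subseteq> L2" using sub by blast
      show "L2_inner \<phi> f \<noteq> 0" using \<phi>(2) by (simp add: f inner)
      fix v assume "v \<in> gabor_system g \<Lambda> - {f}"
      then obtain x' y' where v: "v = tf_shift x' y' g" "(x', y') \<in> \<Lambda>" "v \<noteq> f"
        by (auto simp: gabor_system_def)
      then have "Complex x' (- y') \<noteq> Complex x (- y)" using f by auto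
      then show "L2_inner \<phi> v = 0" using \<phi>(3) mem v by (simp add: inner)
    qed
  qed
  ultimately show ?thesis using sub by (simp add: complete_system_def minimal_system_def)
qed

end
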